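(* With $S_3,S_4$ as in the context, $$S_3(q)=\frac{(q^{45};q^{45})_\infty}{(q^3;q^3)_\infty} \left(2(q^{18},q^{27};q^{45})_\infty+q(q^{12},q^{33};q^{45})_\infty+q^4(q^3,q^{42};q^{45})_\infty\right),$$ $$S_4(q)=\frac{(q^{45};q^{45})_\infty}{(q^3;q^3)_\infty} \left((q^{21},q^{24};q^{45})_\infty -q^3(q^6,q^{39};q^{45})_\infty+2q^2(q^9,q^{36};q^{45})_\infty \right).$$
   Context: Let $|q|<1$ and use standard $q$-Pochhammer notation $(a;q)_n=\prod_{k=0}^{n-1}(1-aq^k)$, $(a;q)_\infty=\prod_{k\ge0}(1-aq^k)$, $(a_1,\dots,a_m;q)_\infty=(a_1;q)_\infty\cdots(a_m;q)_\infty$. Define $$S_3(q)=\sum_{i,j\geq 0} \frac{q^{2i^2+2ij+2j^2-2i-j}}{(q^3;q^3)_i(q^3;q^3)_j},\qquad S_4(q)=\sum_{i,j\geq 0} \frac{q^{2i^2+2ij+2j^2}}{(q^3;q^3)_i(q^3;q^3)_j}.$$ *)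

theory Defs
  imports "HOL-Analysis.Analysis"
begin

definition qpoch :: "complex \<Rightarrow> complex \<Rightarrow> nat \<Rightarrow> complex" where
  "qpoch a q n = (\<Prod>k<n. 1 - a * q ^ k)"

definition qpoch_inf :: "complex \<Rightarrow> complex \<Rightarrow> complex" where
  "qpoch_inf a q = (\<Prod>k. 1 - a * q ^ k)"

definition S3 :: "complex \<Rightarrow> complex" where
  "S3 q = (\<Sum>\<^sub>\<infinity>(i,j)\<in>UNIV.
      q ^ (2*i^2 + 2*i*j + 2*j^2 - 2*i - j) / (qpoch (q^3) (q^3) i * qpoch (q^3) (q^3) j))"

definition S4 :: "complex \<Rightarrow> complex" where
  "S4 q = (\<Sum>\<^sub>\<infinity>(i,j)\<in>UNIV.
      q ^ (2*i^2 + 2*i*j + 2*j^2) / (qpoch (q^3) (q^3) i * qpoch (q^3) (q^3) j))"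

end

theory Submission
  imports Defs
begin

text \<open>
  Write \<open>Q = q^3\<close>, let \<open>w\<close> be a primitive cube root of unity, and let \<open>[n, k]\<close> denote the
  \<open>Q\<close>-binomial coefficient. The heart of the proof is the pair of polynomial identities
  \<open>\<Sum>\<^sub>i\<^sub>j w^(i-j) q^(2i^2+2ij+2j^2) (Q;Q)\<^sub>n / ((Q;Q)\<^sub>i (Q;Q)\<^sub>j (Q;Q)\<^sub>n\<^sub>-\<^sub>i\<^sub>-\<^sub>j) = \<Sum>\<^sub>r (-1)^r q^((5r^2-r)/2) [2n, n-r]\<close> and
  \<open>\<Sum>\<^sub>i\<^sub>j w^(i-j) q^(2i^2+2ij+2j^2-2i-j) (Q;Q)\<^sub>n / ((Q;Q)\<^sub>i (Q;Q)\<^sub>j (Q;Q)\<^sub>n\<^sub>-\<^sub>i\<^sub>-\<^sub>j) = - w^2 \<Sum>\<^sub>r (-1)^r q^((5r^2+3r)/2) [2n-1, n-1-r]\<close>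
  (the second for positive \<open>n\<close>): both sides satisfy the same two coupled first-order recurrences.
  For \<open>n\<close> tending to infinity they evaluate the sums \<open>S4\<close> and \<open>S3\<close> twisted by the character
  \<open>w^(i-j)\<close> as theta functions divided by \<open>(Q;Q)\<^sub>\<infinity>\<close>. The exponents modulo 3 depend only on
  \<open>i - j\<close> modulo 3, so that the untwisted sums are linear combinations of the twisted sums at \<open>q\<close>
  and at \<open>w q\<close>. Replacing \<open>q\<close> by \<open>w q\<close> only rescales the three parts of the theta functions
  belonging to the residue classes of \<open>r\<close> modulo 3, and each of these parts is a product by
  Jacobi's triple product.
\<close>

section \<open>Limits of q-Pochhammer symbols\<close>

text \<open>Dominated convergence for unordered sums (Tannery's theorem): the M-test makes the
  partial sums converge uniformly in \<open>n\<close>, so the two limits may be exchanged. It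
  carries the finite identities over to infinite series.\<close>

lemma tendsto_infsum_dominated:
  fixes f :: "nat \<Rightarrow> 'a \<Rightarrow> 'b :: banach"
  assumes bound: "\<And>n x. norm (f n x) \<le> g x" and "g summable_on UNIV"
    and lim: "\<And>x. (\<lambda>n. f n x) \<longlonglongrightarrow> h x"
  shows "(\<lambda>n. \<Sum>\<^sub>\<infinity>x. f n x) \<longlonglongrightarrow> (\<Sum>\<^sub>\<infinity>x. h x)"
proof (rule swap_uniform_limit')
  show "uniform_limit UNIV (\<lambda>X n. \<Sum>x\<in>X. f n x) (\<lambda>n. \<Sum>\<^sub>\<infinity>x. f n x) (finite_subsets_at_top UNIV)"
    by (rule Weierstrass_m_test_general) (use assms in auto)
  have "norm (h x) \<le> g x" for x
    by (rule Lim_norm_ubound[OF _ lim]) (use bound in auto)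
  then have "(\<lambda>x. norm (h x)) summable_on UNIV"
    by (intro Infinite_Sum.abs_summable_on_comparison_test'[OF assms(2)])
  then have "h summable_on UNIV"
    by (rule abs_summable_summable)
  then show "(sum h \<longlongrightarrow> (\<Sum>\<^sub>\<infinity>x. h x)) (finite_subsets_at_top UNIV)"
    by (rule infsum_tendsto)
  show "\<forall>\<^sub>F X in finite_subsets_at_top UNIV. (\<lambda>n. \<Sum>x\<in>X. f n x) \<longlonglongrightarrow> sum h X"
    by (intro always_eventually allI tendsto_sum lim)
qed auto

lemma qpoch_LIMSEQ:
  assumes "norm q < 1"
  shows "(\<lambda>n. qpoch a q n) \<longlonglongrightarrow> qpoch_inf a q"
proof -
  have "summable (\<lambda>k. norm (1 - a * q ^ k - 1))"
    using assms by (simp add: norm_mult norm_power summable_geometric summable_mult)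
  then have "convergent_prod (\<lambda>k. 1 - a * q ^ k)"
    by (intro abs_convergent_prod_imp_convergent_prod summable_imp_abs_convergent_prod)
  then have "(\<lambda>n. \<Prod>k\<le>n. 1 - a * q ^ k) \<longlonglongrightarrow> qpoch_inf a q"
    unfolding qpoch_inf_def by (rule convergent_prod_LIMSEQ)
  then show ?thesis
    unfolding qpoch_def by (rule LIMSEQ_lessThan_iff_atMost[THEN iffD2])
qed

lemma one_minus_power_neq_0:
  fixes q :: complex
  assumes "norm q < 1" "n > 0"
  shows "1 - q ^ n \<noteq> 0"
proof
  assume "1 - q ^ n = 0"
  then have "norm q ^ n = 1"
    by (simp flip: norm_power)
  moreover have "norm q ^ n < 1"
    using assms by (intro power_less_one_iff[THEN iffD2]) auto
  ultimately show False
    by simp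
qed

lemma qpoch_neq_0:
  assumes "norm q < 1"
  shows "qpoch q q n \<noteq> 0"
  using one_minus_power_neq_0[OF assms, of "Suc _"] by (auto simp: qpoch_def)

lemma qpoch_inf_neq_0:
  assumes "norm q < 1"
  shows "qpoch_inf q q \<noteq> 0"
  unfolding qpoch_inf_def
proof (rule prodinf_nonzero)
  have "summable (\<lambda>k. norm (1 - q * q ^ k - 1))"
    using assms by (simp add: norm_mult norm_power summable_geometric summable_mult)
  then show "convergent_prod (\<lambda>k. 1 - q * q ^ k)"
    by (intro abs_convergent_prod_imp_convergent_prod summable_imp_abs_convergent_prod)
  show "1 - q * q ^ k \<noteq> 0" for k
    using one_minus_power_neq_0[OF assms, of "Suc k"] by simp
qed

lemma qpoch_Suc: "qpoch a q (Suc n) = (1 - a * q ^ n) * qpoch a q n"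
  by (simp add: qpoch_def)

lemma qpoch_0 [simp]: "qpoch a q 0 = 1"
  by (simp add: qpoch_def)

text \<open>The convention \<open>1 / (q; q)\<^sub>k = 0\<close> for \<open>k < 0\<close> makes the recursion below hold for
  all integers \<open>k\<close>, so that boundary terms of all finite sums take care of themselves.\<close>
definition inv_qpoch :: "complex \<Rightarrow> int \<Rightarrow> complex" where
  "inv_qpoch q k = (if k < 0 then 0 else 1 / qpoch q q (nat k))"

lemma inv_qpoch_neg [simp]: "k < 0 \<Longrightarrow> inv_qpoch q k = 0"
  by (simp add: inv_qpoch_def)

lemma inv_qpoch_0 [simp]: "inv_qpoch q 0 = 1"
  by (simp add: inv_qpoch_def)

lemma inv_qpoch_of_nat: "inv_qpoch q (int n) = 1 / qpoch q q n"
  by (simp add: inv_qpoch_def)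

lemma inv_qpoch_diff_1:
  assumes "norm q < 1"
  shows "inv_qpoch q (k - 1) = (1 - q powi k) * inv_qpoch q k"
proof (cases "k \<le> 0")
  case True
  \<comment> \<open>At \<open>k = 0\<close> the factor \<open>1 - q powi 0\<close> vanishes, in
    agreement with the value 0 at index \<open>- 1\<close>.\<close>
  then show ?thesis
    by (cases "k = 0") auto
next
  case False
  then obtain n where k: "k = int (Suc n)"
    by (metis not_le zero_less_imp_eq_int gr0_conv_Suc)
  then have "nat (k - 1) = n" "nat k = Suc n" "\<not> k - 1 < 0" "\<not> k < 0"
    by auto
  moreover have "q powi k = q * q ^ n"
    unfolding k by (simp only: power_int_of_nat power_Suc)
  ultimately show ?thesis
    using one_minus_power_neq_0[OF assms, of "Suc n"] qpoch_neq_0[OF assms, of n]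
    by (simp add: inv_qpoch_def qpoch_Suc)
qed

lemma qpoch_bounded:
  assumes "norm q < 1"
  obtains B where "B > 0" "\<And>n. norm (qpoch a q n) \<le> B"
proof -
  have "Bseq (\<lambda>n. qpoch a q n)"
    using qpoch_LIMSEQ[OF assms] by (meson convergentI convergent_imp_Bseq)
  then show ?thesis
    using that by (auto elim!: BseqE)
qed

lemma inv_qpoch_LIMSEQ:
  assumes "norm q < 1"
  shows "(\<lambda>n. inv_qpoch q (int n + k)) \<longlonglongrightarrow> 1 / qpoch_inf q q"
proof -
  have lim: "(\<lambda>n. inv_qpoch q (int n)) \<longlonglongrightarrow> 1 / qpoch_inf q q"
    unfolding inv_qpoch_of_nat
    using qpoch_LIMSEQ[OF assms] qpoch_inf_neq_0[OF assms] by (intro tendsto_divide) auto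
  have "filterlim (\<lambda>n. nat (int n + k)) at_top at_top"
  proof (rule filterlim_at_top_mono)
    show "filterlim (\<lambda>n. n - nat (- k)) at_top at_top"
      by (rule filterlim_minus_const_nat_at_top)
  qed (auto intro!: always_eventually)
  then have "(\<lambda>n. inv_qpoch q (int (nat (int n + k)))) \<longlonglongrightarrow> 1 / qpoch_inf q q"
    by (rule filterlim_compose[OF lim])
  then show ?thesis
  proof (rule Lim_transform_eventually)
    show "\<forall>\<^sub>F n in sequentially. inv_qpoch q (int (nat (int n + k))) = inv_qpoch q (int n + k)"
      using eventually_ge_at_top[of "nat (- k)"] by eventually_elim auto
  qed
qed

lemma inv_qpoch_bounded:
  assumes "norm q < 1"
  obtains B where "B > 0" "\<And>k. norm (inv_qpoch q k) \<le> B"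
proof -
  have "(\<lambda>n. inv_qpoch q (int n)) \<longlonglongrightarrow> 1 / qpoch_inf q q"
    using inv_qpoch_LIMSEQ[OF assms, of 0] by simp
  then have "Bseq (\<lambda>n. inv_qpoch q (int n))"
    by (meson convergentI convergent_imp_Bseq)
  then obtain B where B: "B > 0" "\<And>n. norm (inv_qpoch q (int n)) \<le> B"
    by (auto elim!: BseqE)
  have "norm (inv_qpoch q k) \<le> B" for k
  proof (cases "k < 0")
    case False
    then show ?thesis
      using B(2)[of "nat k"] by simp
  qed (use B in auto)
  with B that show ?thesis
    by blast
qed

section \<open>Recurrences for sums of Gaussian binomial coefficients\<close>

text \<open>General term of Jacobi's theta series; the division by 2 is exact because
  \<open>r * (r - 1)\<close> is even. With base \<open>q ^ 5\<close>, the choices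
  \<open>z = q ^ 2\<close> and \<open>z = q ^ 4\<close> give the exponents (5r^2 - r)/2 and (5r^2 +
  3r)/2.\<close>

definition theta_term :: "complex \<Rightarrow> complex \<Rightarrow> int \<Rightarrow> complex" where
  "theta_term z q r = (- z) powi r * q powi (r * (r - 1) div 2)"

lemma triangular_add_1: "(r + 1) * (r + 1 - 1) div 2 = r * (r - 1) div 2 + (r :: int)"
proof -
  have "(r + 1) * (r + 1 - 1) = r * (r - 1) + r * 2"
    by (simp add: algebra_simps)
  then show ?thesis
    by simp
qed

lemma theta_term_add_1:
  assumes "z \<noteq> 0" "q \<noteq> 0"
  shows "theta_term z q (r + 1) = - z * q powi r * theta_term z q r"
  using assms unfolding theta_term_def triangular_add_1
  by (simp add: power_int_add)

text \<open>The reflection r -> -1 - r interchanges n - r and n + 1 + r, so it preserves products of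
  inverse Pochhammer symbols at these indices. It raises the triangular exponent by 2r + 1 and
  lowers the exponent of - z by the same odd number, whence the sign.\<close>

lemma theta_term_reflect:
  assumes "z \<noteq> 0" "q \<noteq> 0"
  shows "theta_term z q (- 1 - r) = - (q powi (2 * r + 1) / z powi (2 * r + 1)) * theta_term z q r"
proof -
  have "(- 1 - r) * (- 1 - r - 1) = r * (r - 1) + (2 * r + 1) * 2"
    by (simp add: algebra_simps)
  then have "(- 1 - r) * (- 1 - r - 1) div 2 = r * (r - 1) div 2 + (2 * r + 1)"
    by simp
  moreover have "(- z) powi (- 1 - r) = - ((- z) powi r) / z powi (2 * r + 1)"
  proof -
    have "(- z) powi (- 1 - r) = (- z) powi (r - (2 * r + 1))"
      by (rule arg_cong[where f = "\<lambda>k. (- z) powi k"]) simp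
    also have "\<dots> = (- z) powi r / (- z) powi (2 * r + 1)"
      using assms by (subst power_int_diff) auto
    also have "(- z) powi (2 * r + 1) = - (z powi (2 * r + 1))"
      by (simp add: power_int_minus_left)
    finally show ?thesis
      by simp
  qed
  ultimately show ?thesis
    using assms unfolding theta_term_def by (simp add: power_int_add)
qed

text \<open>Makes the telescoping differences \<open>G r - G (r + 1)\<close> of the recurrence
  proofs sum to 0 over the cutoff range.\<close>

lemma sum_int_shift:
  fixes f :: "int \<Rightarrow> 'a :: ab_group_add"
  assumes "f (- N) = 0" "f (N + 1) = 0" "N \<ge> 0"
  shows "(\<Sum>r = - N..N. f (r + 1)) = (\<Sum>r = - N..N. f r)"
proof -
  have "(\<Sum>r = - N..N. f (r + 1)) = (\<Sum>r = - N + 1..N + 1. f r)"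
    by (intro sum.reindex_bij_witness[of _ "\<lambda>r. r - 1" "\<lambda>r. r + 1"]) auto
  also have "\<dots> = (\<Sum>r = - N..N + 1. f r)"
  proof (rule sum.mono_neutral_left)
    show "\<forall>i\<in>{- N..N + 1} - {- N + 1..N + 1}. f i = 0"
    proof
      fix i assume "i \<in> {- N..N + 1} - {- N + 1..N + 1}"
      then have "i = - N"
        by auto
      with assms show "f i = 0"
        by simp
    qed
  qed auto
  also have "\<dots> = (\<Sum>r = - N..N. f r)"
  proof (rule sum.mono_neutral_right)
    show "\<forall>i\<in>{- N..N + 1} - {- N..N}. f i = 0"
    proof
      fix i assume "i \<in> {- N..N + 1} - {- N..N}"
      then have "i = N + 1"
        by auto
      with assms show "f i = 0"
        by simp
    qed
  qed auto
  finally show ?thesis .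
qed

text \<open>The reflection maps \<open>{- N..N - 1}\<close> to itself; the index \<open>N\<close>
  stays unpaired, so the summand has to vanish there.\<close>

lemma sum_int_antisym:
  fixes f :: "int \<Rightarrow> complex"
  assumes "\<And>r. f (- 1 - r) = - f r" "f N = 0" "N \<ge> 0"
  shows "(\<Sum>r = - N..N. f r) = 0"
proof -
  have "(\<Sum>r = - N..N. f r) = (\<Sum>r = - N..N - 1. f r)"
    by (rule sum.mono_neutral_right) (use assms in \<open>auto simp: not_le not_less\<close>)
  also have "\<dots> = (\<Sum>r = - N..N - 1. f (- 1 - r))"
    by (intro sum.reindex_bij_witness[of _ "\<lambda>r. - 1 - r" "\<lambda>r. - 1 - r"]) auto
  also have "\<dots> = - (\<Sum>r = - N..N - 1. f r)"
    by (simp add: assms(1) sum_negf)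
  also have "(\<Sum>r = - N..N - 1. f r) = (\<Sum>r = - N..N. f r)"
    by (rule sum.mono_neutral_left) (use assms in \<open>auto simp: not_le not_less\<close>)
  finally show ?thesis
    by simp
qed

lemma powi_power_swap: "(q ^ k) powi r = (q powi r) ^ k" for q :: complex
  by (simp add: power_int_power power_int_power' mult.commute)

text \<open>Lets the even and the odd sum share the weight
  \<open>theta_term (q ^ 2) (q ^ 5)\<close>, so that their summands can be compared as rational
  functions of \<open>q powi r\<close>.\<close>

lemma theta_term_4_5:
  "theta_term (q ^ 4) (q ^ 5) r = theta_term (q ^ 2) (q ^ 5) r * (q powi r) ^ 2"
proof -
  have "- (q ^ 4) = - (q ^ 2) * q ^ 2"
    by (simp flip: power_add)
  then show ?thesis
    unfolding theta_term_def by (simp only: power_int_mult_distrib) (simp add: powi_power_swap)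
qed

lemma theta_term_2_5_add_1:
  assumes "q \<noteq> 0"
  shows "theta_term (q ^ 2) (q ^ 5) (r + 1) = - (q ^ 2 * (q powi r) ^ 5) * theta_term (q ^ 2) (q ^ 5) r"
  using assms by (subst theta_term_add_1) (simp_all add: powi_power_swap)

lemma theta_term_2_5_reflect:
  assumes "q \<noteq> 0"
  shows "theta_term (q ^ 2) (q ^ 5) (- 1 - r) = - (q ^ 3 * (q powi r) ^ 6) * theta_term (q ^ 2) (q ^ 5) r"
proof -
  have "q powi (2 * r + 1) = q * (q powi r) ^ 2"
    using assms by (simp add: power_int_add power_int_power' mult.commute)
  moreover have "x ^ 5 / x ^ 2 = x ^ 3" for x :: complex
    by (cases "x = 0") (simp_all add: field_simps flip: power_add)
  ultimately have "(q ^ 5) powi (2 * r + 1) / (q ^ 2) powi (2 * r + 1) = (q * (q powi r) ^ 2) ^ 3"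
    by (simp only: powi_power_swap)
  also have "\<dots> = q ^ 3 * (q powi r) ^ 6"
    by (simp add: power_mult_distrib flip: power_mult)
  finally show ?thesis
    using assms by (subst theta_term_reflect) simp_all
qed

lemma inv_qpoch_cube_diff_1:
  assumes "norm q < 1"
  shows "inv_qpoch (q ^ 3) (k - 1) = (1 - (q powi k) ^ 3) * inv_qpoch (q ^ 3) k"
proof -
  have "norm (q ^ 3) < 1"
    using assms by (simp add: norm_power power_less_one_iff)
  then show ?thesis
    by (simp add: inv_qpoch_diff_1 powi_power_swap)
qed

text \<open>In the notation above, \<open>rr_even q N n\<close> is the sum over \<open>[2n, n - r]\<close> and \<open>rr_odd q N n\<close> the one over
  \<open>[2n + 1, n - r]\<close>. The parameter \<open>N\<close> is only a cutoff: the summands vanish unless \<open>- n - 1 \<le> r \<le> n\<close>.\<close>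
definition rr_even :: "complex \<Rightarrow> int \<Rightarrow> nat \<Rightarrow> complex" where
  "rr_even q N n = qpoch (q ^ 3) (q ^ 3) (2 * n) *
     (\<Sum>r = - N..N. theta_term (q ^ 2) (q ^ 5) r * inv_qpoch (q ^ 3) (int n - r) * inv_qpoch (q ^ 3) (int n + r))"

definition rr_odd :: "complex \<Rightarrow> int \<Rightarrow> nat \<Rightarrow> complex" where
  "rr_odd q N n = qpoch (q ^ 3) (q ^ 3) (2 * n + 1) *
     (\<Sum>r = - N..N. theta_term (q ^ 4) (q ^ 5) r * inv_qpoch (q ^ 3) (int n - r) * inv_qpoch (q ^ 3) (int n + 1 + r))"

lemma rr_even_0:
  assumes "K \<ge> 0"
  shows "rr_even q K 0 = 1"
proof -
  have "theta_term (q ^ 2) (q ^ 5) r * inv_qpoch (q ^ 3) (int 0 - r) * inv_qpoch (q ^ 3) (int 0 + r)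
      = (if r = 0 then 1 else 0)" for r
    by (auto simp: theta_term_def inv_qpoch_def)
  then show ?thesis
    using assms unfolding rr_even_def by simp
qed

lemma rr_odd_0:
  assumes q: "norm q < 1" "q \<noteq> 0" and "K \<ge> 1"
  shows "rr_odd q K 0 = 1 - q"
proof -
  have q3: "1 - q ^ 3 \<noteq> 0"
    using q by (intro one_minus_power_neq_0) auto
  have ip1: "inv_qpoch (q ^ 3) 1 = 1 / (1 - q ^ 3)"
    by (simp add: inv_qpoch_def qpoch_def)
  \<comment> \<open>The inverse Pochhammer factors at \<open>- r\<close> and \<open>1 + r\<close>
    leave only \<open>r = 0\<close> and \<open>r = - 1\<close>; \<open>K \<ge> 1\<close> keeps the
    latter in range.\<close>
  have "theta_term (q ^ 4) (q ^ 5) r * inv_qpoch (q ^ 3) (int 0 - r) * inv_qpoch (q ^ 3) (int 0 + 1 + r)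
      = (if r = 0 then 1 / (1 - q ^ 3) else 0) + (if r = - 1 then - q / (1 - q ^ 3) else 0)" for r
  proof -
    consider "r = 0" | "r = - 1" | "r > 0" | "r < - 1"
      by linarith
    then show ?thesis
      using q by cases (simp_all add: theta_term_def ip1 power_int_minus divide_simps, simp_all flip: power_Suc)
  qed
  then have "rr_odd q K 0 = qpoch (q ^ 3) (q ^ 3) 1 * (\<Sum>r = - K..K. (if r = 0 then 1 / (1 - q ^ 3) else 0)
      + (if r = - 1 then - q / (1 - q ^ 3) else 0))"
    unfolding rr_odd_def by simp
  also have "\<dots> = (1 - q ^ 3) * (1 / (1 - q ^ 3) + - q / (1 - q ^ 3))"
    using assms by (simp add: sum.distrib qpoch_def)
  also have "\<dots> = 1 - q"
    using q3 by (simp add: field_simps)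
  finally show ?thesis .
qed

text \<open>The summand identity of \<open>rr_even_Suc\<close> after cancelling
  \<open>e r * ip (m - r) * ip (m + r)\<close>, where \<open>t\<close> stands for
  \<open>q powi r\<close> and \<open>M\<close> for \<open>q ^ (3 * n + 3)\<close>. The three terms
  on the right come from \<open>G r\<close>, \<open>- G (r + 1)\<close> and
  \<open>F r\<close>.\<close>

lemma rr_even_Suc_identity:
  fixes q t M :: complex
  assumes "q \<noteq> 0" "t \<noteq> 0"
  shows "(1 - M ^ 2) - (1 - M / t ^ 3) * (1 - M * t ^ 3) + M / q * (t ^ 2 * (1 - M / t ^ 3)) =
     M * ((1 - M * t ^ 3) / t ^ 3 + q ^ 2 * t ^ 5 / (q * t) ^ 3 * (1 - M / t ^ 3) + t ^ 3 * (1 - M / t ^ 3))"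
  using assms by (simp add: divide_simps) algebra

text \<open>The summand of the recurrence is the sum of a telescoping part, coming from \<open>G\<close>, and a part \<open>F\<close>
  that is antisymmetric under \<open>r \<mapsto> - 1 - r\<close>.\<close>
lemma rr_even_Suc:
  assumes q: "q \<noteq> 0" "norm q < 1" and N: "int n + 2 \<le> N"
  shows "rr_even q N (Suc n) = (1 - q ^ (6 * n + 3)) * rr_even q N n - q ^ (3 * n + 2) * rr_odd q N n"
proof -
  define ip where "ip = inv_qpoch (q ^ 3)"
  define e where "e = theta_term (q ^ 2) (q ^ 5)"
  define m where "m = int (Suc n)"
  define M where "M = q ^ (3 * n + 3)"
  define G where "G = (\<lambda>r. e r / (q powi r) ^ 3 * ip (m - r) * ip (m + r - 1))"
  define F where "F = (\<lambda>r. e r * (q powi r) ^ 3 * ip (m - 1 - r) * ip (m + r))"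
  define P where "P = qpoch (q ^ 3) (q ^ 3) (2 * n)"
  \<comment> \<open>Since \<open>M ^ 2 / q ^ 3 = q ^ (6 * n + 3)\<close>, this is both the
    Pochhammer factor gained from \<open>2 * n\<close> to \<open>2 * n + 1\<close> and the
    coefficient of \<open>rr_even q N n\<close>.\<close>
  define c where "c = 1 - M ^ 2 / q ^ 3"
  have ip: "ip (k - 1) = (1 - (q powi k) ^ 3) * ip k" for k
    unfolding ip_def by (rule inv_qpoch_cube_diff_1[OF q(2)])
  have M: "(q powi m) ^ 3 = M"
  proof -
    have "q powi m = q ^ Suc n"
      unfolding m_def by (rule power_int_of_nat)
    then show ?thesis
      by (simp add: M_def power_add power_mult_distrib mult.commute flip: power_mult)
  qed
  have p1: "qpoch (q ^ 3) (q ^ 3) (2 * n + 1) = c * P"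
    and p2: "qpoch (q ^ 3) (q ^ 3) (2 * Suc n) = (1 - M ^ 2) * c * P"
    and p3: "q ^ (6 * n + 3) = M ^ 2 / q ^ 3" and p4: "q ^ (3 * n + 2) = M / q"
  proof -
    have M': "M = (q ^ n) ^ 3 * q ^ 3"
      by (simp add: M_def power_add mult.commute flip: power_mult)
    have "q ^ (6 * n + 3) = (q ^ n) ^ 6 * q ^ 3"
      by (simp add: power_add mult.commute flip: power_mult)
    also have "\<dots> = M ^ 2 / q ^ 3"
      unfolding M' using q by (simp add: divide_simps)
    finally show p3: "q ^ (6 * n + 3) = M ^ 2 / q ^ 3" .
    have "M = q ^ (3 * n + 2) * q"
      by (simp add: M_def power3_eq_cube power_add)
    then show "q ^ (3 * n + 2) = M / q"
      by (simp only: nonzero_mult_div_cancel_right[OF q(1)])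
    have "qpoch (q ^ 3) (q ^ 3) (2 * n + 1) = (1 - q ^ (6 * n + 3)) * P"
      by (simp add: qpoch_Suc P_def power_add mult.commute flip: power_mult)
    then show p1: "qpoch (q ^ 3) (q ^ 3) (2 * n + 1) = c * P"
      by (simp add: p3 c_def)
    have "qpoch (q ^ 3) (q ^ 3) (2 * Suc n) = (1 - q ^ 3 * (q ^ 3) ^ (2 * n + 1)) * qpoch (q ^ 3) (q ^ 3) (2 * n + 1)"
      by (simp add: qpoch_Suc)
    also have "q ^ 3 * (q ^ 3) ^ (2 * n + 1) = q ^ (3 + 3 * (2 * n + 1))"
      by (simp only: power_add power_mult)
    also have "3 + 3 * (2 * n + 1) = (3 * n + 3) * 2"
      by simp
    also have "q ^ \<dots> = M ^ 2"
      by (simp only: M_def power_mult)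
    finally show "qpoch (q ^ 3) (q ^ 3) (2 * Suc n) = (1 - M ^ 2) * c * P"
      by (simp only: p1 mult.assoc)
  qed
  have F0: "(\<Sum>r = - N..N. F r) = 0"
  proof (rule sum_int_antisym)
    show "F (- 1 - r) = - F r" for r
    proof -
      define t where "t = q powi r"
      define s where "s = 1 / (q * t)"
      have "t \<noteq> 0"
        using q by (simp add: t_def)
      then have s: "q ^ 3 * t ^ 6 * s ^ 3 = t ^ 3"
        using q unfolding s_def by (simp add: divide_simps)
      have "q powi (- 1 - r) = s"
        using q by (simp add: s_def t_def power_int_diff power_int_minus field_simps)
      moreover have "m - 1 - (- 1 - r) = m + r" "m + (- 1 - r) = m - 1 - r"
        by simp_all
      ultimately have "F (- 1 - r) = - (q ^ 3 * t ^ 6 * s ^ 3) * (e r * ip (m - 1 - r) * ip (m + r))"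
        unfolding F_def e_def theta_term_2_5_reflect[OF q(1)] t_def[symmetric] by (simp only:) (simp add: mult_ac)
      also have "\<dots> = - F r"
        unfolding s F_def t_def[symmetric] by (simp add: algebra_simps)
      finally show ?thesis .
    qed
    show "F N = 0" "N \<ge> 0"
      using N by (auto simp: F_def ip_def m_def)
  qed
  have G0: "(\<Sum>r = - N..N. G (r + 1)) = (\<Sum>r = - N..N. G r)"
    by (rule sum_int_shift) (use N in \<open>auto simp: G_def ip_def m_def\<close>)
  have "(1 - M ^ 2) * c * P * (e r * ip (m - r) * ip (m + r))
      - c * (P * (e r * ip (m - 1 - r) * ip (m - 1 + r)))
      + M / q * (c * P * (e r * (q powi r) ^ 2 * ip (m - 1 - r) * ip (m + r)))
     = P * c * M * (G r - G (r + 1) + F r)" for r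
  proof -
    define t where "t = q powi r"
    define a where "a = ip (m - r)"
    define b where "b = ip (m + r)"
    have t: "t \<noteq> 0"
      using q by (simp add: t_def)
    have ip1: "ip (m - 1 - r) = (1 - M / t ^ 3) * a"
      using ip[of "m - r"] q by (simp add: power_int_diff power_divide M t_def a_def algebra_simps)
    have ip2: "ip (m + r - 1) = (1 - M * t ^ 3) * b"
      using ip[of "m + r"] q by (simp add: power_int_add power_mult_distrib M t_def b_def)
    have ip2': "ip (m - 1 + r) = (1 - M * t ^ 3) * b"
      using ip2 by (simp add: algebra_simps)
    have G: "G r = e r / t ^ 3 * a * ((1 - M * t ^ 3) * b)"
      unfolding G_def ip2 t_def a_def ..
    have G': "G (r + 1) = - (q ^ 2 * t ^ 5) * e r / (q * t) ^ 3 * ((1 - M / t ^ 3) * a) * b"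
    proof -
      have "m - (r + 1) = m - 1 - r" "m + (r + 1) - 1 = m + r" "q powi (r + 1) = q * t"
        using q by (simp_all add: power_int_add t_def)
      then show ?thesis
        unfolding G_def e_def theta_term_2_5_add_1[OF q(1)] by (simp only: ip1 b_def t_def)
    qed
    have "(1 - M ^ 2) * c * P * (e r * ip (m - r) * ip (m + r))
        - c * (P * (e r * ip (m - 1 - r) * ip (m - 1 + r)))
        + M / q * (c * P * (e r * (q powi r) ^ 2 * ip (m - 1 - r) * ip (m + r)))
      = P * c * (e r * a * b) * ((1 - M ^ 2) - (1 - M / t ^ 3) * (1 - M * t ^ 3) + M / q * (t ^ 2 * (1 - M / t ^ 3)))"
      unfolding ip1 ip2' a_def[symmetric] b_def[symmetric] t_def[symmetric] by algebra
    also have "\<dots> = P * c * (e r * a * b) * (M * ((1 - M * t ^ 3) / t ^ 3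
         + q ^ 2 * t ^ 5 / (q * t) ^ 3 * (1 - M / t ^ 3) + t ^ 3 * (1 - M / t ^ 3)))"
      by (simp only: rr_even_Suc_identity[OF q(1) t])
    also have "\<dots> = P * c * M * (G r - G (r + 1) + F r)"
      unfolding G G' F_def ip1 b_def[symmetric] t_def[symmetric] by algebra
    finally show ?thesis .
  qed
  then have "(\<Sum>r = - N..N. (1 - M ^ 2) * c * P * (e r * ip (m - r) * ip (m + r))
      - c * (P * (e r * ip (m - 1 - r) * ip (m - 1 + r)))
      + M / q * (c * P * (e r * (q powi r) ^ 2 * ip (m - 1 - r) * ip (m + r))))
     = P * c * M * ((\<Sum>r = - N..N. G r) - (\<Sum>r = - N..N. G (r + 1)) + (\<Sum>r = - N..N. F r))"
    by (simp only: sum.distrib sum_subtractf sum_distrib_left[symmetric])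
  then have "(1 - M ^ 2) * c * P * (\<Sum>r = - N..N. e r * ip (m - r) * ip (m + r))
      - c * (P * (\<Sum>r = - N..N. e r * ip (m - 1 - r) * ip (m - 1 + r)))
      + M / q * (c * P * (\<Sum>r = - N..N. e r * (q powi r) ^ 2 * ip (m - 1 - r) * ip (m + r))) = 0"
    unfolding F0 G0 by (simp only: sum.distrib sum_subtractf sum_distrib_left[symmetric]) simp
  moreover have "rr_even q N (Suc n) = (1 - M ^ 2) * c * P * (\<Sum>r = - N..N. e r * ip (m - r) * ip (m + r))"
    unfolding rr_even_def p2 by (simp add: e_def ip_def m_def algebra_simps)
  moreover have "rr_even q N n = P * (\<Sum>r = - N..N. e r * ip (m - 1 - r) * ip (m - 1 + r))"
    unfolding rr_even_def by (simp add: P_def e_def ip_def m_def)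
  moreover have "rr_odd q N n = c * P * (\<Sum>r = - N..N. e r * (q powi r) ^ 2 * ip (m - 1 - r) * ip (m + r))"
    unfolding rr_odd_def p1 theta_term_4_5 by (simp add: e_def ip_def m_def add.commute)
  ultimately have "rr_even q N (Suc n) - c * rr_even q N n + M / q * rr_odd q N n = 0"
    by (simp only:)
  then show ?thesis
    unfolding p3 p4 c_def by (simp add: algebra_simps)
qed


text \<open>The analogue for \<open>rr_odd_Suc\<close>, with
  \<open>e r * ip (m - r) * ip (m + 1 + r)\<close> cancelled. The terms 1 / t + (1 - M) q and 1 / (q
  t) + (1 - M) q are the telescoping weight at \<open>r\<close> and \<open>r + 1\<close>; the last
  bracket is the antisymmetric remainder.\<close>

lemma rr_odd_Suc_identity:
  fixes q t M :: complex
  assumes "q \<noteq> 0" "t \<noteq> 0"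
  shows "(1 - M ^ 2 * q ^ 3) * (1 - M ^ 2) * t ^ 2 - (1 + M) * (t ^ 2 * (1 - M / t ^ 3) * (1 - M * q ^ 3 * t ^ 3))
       + q * M * ((1 - M ^ 2) * (1 - M * q ^ 3 * t ^ 3)) =
     M * (1 + M) * ((1 / t + (1 - M) * q) * (1 - M * q ^ 3 * t ^ 3)
       + q ^ 2 * t ^ 5 * (1 / (q * t) + (1 - M) * q) * (1 - M / t ^ 3)
       + (M * (q * t + q ^ 3 * t ^ 5) - t ^ 2 - q * t ^ 4))"
  using assms by (simp add: divide_simps) algebra

text \<open>Again a telescoping part \<open>G\<close> plus a part \<open>F\<close> that is odd under
  r -> -1 - r. The even sum enters at \<open>Suc n\<close>, so this recurrence and
  \<open>rr_even_Suc\<close> alternately determine all values from those at 0.\<close>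

lemma rr_odd_Suc:
  assumes q: "q \<noteq> 0" "norm q < 1" and N: "int n + 3 \<le> N"
  shows "rr_odd q N (Suc n) = (1 + q ^ (3 * n + 3)) * rr_odd q N n - q ^ (3 * n + 4) * rr_even q N (Suc n)"
proof -
  define ip where "ip = inv_qpoch (q ^ 3)"
  define e where "e = theta_term (q ^ 2) (q ^ 5)"
  define m where "m = int (Suc n)"
  define M where "M = q ^ (3 * n + 3)"
  define f where "f = (\<lambda>t. 1 / t + (1 - M) * q)"
  define G where "G = (\<lambda>r. e r * f (q powi r) * ip (m - r) * ip (m + r))"
  define F where "F = (\<lambda>r. e r * (M * (q * q powi r + q ^ 3 * (q powi r) ^ 5) - (q powi r) ^ 2 - q * (q powi r) ^ 4)
     * ip (m - r) * ip (m + 1 + r))"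
  define P where "P = qpoch (q ^ 3) (q ^ 3) (2 * n + 1)"
  have ip: "ip (k - 1) = (1 - (q powi k) ^ 3) * ip k" for k
    unfolding ip_def by (rule inv_qpoch_cube_diff_1[OF q(2)])
  have M: "(q powi m) ^ 3 = M"
  proof -
    have "q powi m = q ^ Suc n"
      unfolding m_def by (rule power_int_of_nat)
    then show ?thesis
      by (simp add: M_def power_add power_mult_distrib mult.commute flip: power_mult)
  qed
  have p1: "qpoch (q ^ 3) (q ^ 3) (2 * Suc n) = (1 - M ^ 2) * P"
  proof -
    have "qpoch (q ^ 3) (q ^ 3) (2 * Suc n) = (1 - q ^ 3 * (q ^ 3) ^ (2 * n + 1)) * qpoch (q ^ 3) (q ^ 3) (2 * n + 1)"
      by (simp add: qpoch_Suc)
    also have "q ^ 3 * (q ^ 3) ^ (2 * n + 1) = q ^ (3 + 3 * (2 * n + 1))"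
      by (simp only: power_add power_mult)
    also have "3 + 3 * (2 * n + 1) = (3 * n + 3) * 2"
      by simp
    also have "q ^ \<dots> = M ^ 2"
      by (simp only: M_def power_mult)
    finally show ?thesis
      by (simp add: P_def)
  qed
  have p2: "qpoch (q ^ 3) (q ^ 3) (2 * Suc n + 1) = (1 - M ^ 2 * q ^ 3) * (1 - M ^ 2) * P"
  proof -
    have "qpoch (q ^ 3) (q ^ 3) (2 * Suc n + 1) = (1 - q ^ 3 * (q ^ 3) ^ (2 * Suc n)) * qpoch (q ^ 3) (q ^ 3) (2 * Suc n)"
      by (simp add: qpoch_Suc)
    also have "q ^ 3 * (q ^ 3) ^ (2 * Suc n) = q ^ (3 + 3 * (2 * Suc n))"
      by (simp only: power_add power_mult)
    also have "3 + 3 * (2 * Suc n) = (3 * n + 3) * 2 + 3"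
      by simp
    also have "q ^ \<dots> = M ^ 2 * q ^ 3"
      by (simp only: M_def power_add power_mult)
    finally show ?thesis
      by (simp only: p1 mult.assoc)
  qed
  have p4: "q ^ (3 * n + 4) = q * M"
    by (simp add: M_def add.commute flip: power_Suc)
  have F0: "(\<Sum>r = - N..N. F r) = 0"
  proof (rule sum_int_antisym)
    show "F (- 1 - r) = - F r" for r
    proof -
      define t where "t = q powi r"
      define s where "s = 1 / (q * t)"
      have "t \<noteq> 0"
        using q by (simp add: t_def)
      \<comment> \<open>The map t -> 1 / (q t), followed by multiplication by q^3 t^6, swaps q t
        with q^3 t^5 and t^2 with q t^4.\<close>
      then have s: "q ^ 3 * t ^ 6 * (M * (q * s + q ^ 3 * s ^ 5) - s ^ 2 - q * s ^ 4)
          = M * (q * t + q ^ 3 * t ^ 5) - t ^ 2 - q * t ^ 4"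
        using q unfolding s_def by (simp add: divide_simps) algebra
      have "q powi (- 1 - r) = s"
        using q by (simp add: s_def t_def power_int_diff power_int_minus field_simps)
      moreover have "m - (- 1 - r) = m + 1 + r" "m + 1 + (- 1 - r) = m - r"
        by simp_all
      ultimately have "F (- 1 - r) = - (q ^ 3 * t ^ 6 * (M * (q * s + q ^ 3 * s ^ 5) - s ^ 2 - q * s ^ 4))
          * (e r * ip (m - r) * ip (m + 1 + r))"
        unfolding F_def e_def theta_term_2_5_reflect[OF q(1)] t_def[symmetric] by (simp only:) (simp add: mult_ac)
      also have "\<dots> = - F r"
        unfolding s F_def t_def[symmetric] by (simp add: algebra_simps)
      finally show ?thesis .
    qed
    show "F N = 0" "N \<ge> 0"
      using N by (auto simp: F_def ip_def m_def)
  qed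
  have G0: "(\<Sum>r = - N..N. G (r + 1)) = (\<Sum>r = - N..N. G r)"
    by (rule sum_int_shift) (use N in \<open>auto simp: G_def ip_def m_def\<close>)
  have "(1 - M ^ 2 * q ^ 3) * (1 - M ^ 2) * P * (e r * (q powi r) ^ 2 * ip (m - r) * ip (m + 1 + r))
      - (1 + M) * (P * (e r * (q powi r) ^ 2 * ip (m - 1 - r) * ip (m + r)))
      + q * M * ((1 - M ^ 2) * P * (e r * ip (m - r) * ip (m + r)))
     = P * M * (1 + M) * (G r - G (r + 1) + F r)" for r
  proof -
    define t where "t = q powi r"
    define a where "a = ip (m - r)"
    define b where "b = ip (m + 1 + r)"
    have t: "t \<noteq> 0"
      using q by (simp add: t_def)
    have ip1: "ip (m - 1 - r) = (1 - M / t ^ 3) * a"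
      using ip[of "m - r"] q by (simp add: power_int_diff power_divide M t_def a_def algebra_simps)
    have ip2: "ip (m + r) = (1 - M * q ^ 3 * t ^ 3) * b"
      using ip[of "m + 1 + r"] q by (simp add: power_int_add power_mult_distrib M t_def b_def)
    have G: "G r = e r * f t * a * ((1 - M * q ^ 3 * t ^ 3) * b)"
      unfolding G_def ip2 t_def a_def ..
    have G': "G (r + 1) = - (q ^ 2 * t ^ 5) * e r * f (q * t) * ((1 - M / t ^ 3) * a) * b"
    proof -
      have "m - (r + 1) = m - 1 - r" "m + (r + 1) = m + 1 + r" "q powi (r + 1) = q * t"
        using q by (simp_all add: power_int_add t_def)
      then show ?thesis
        unfolding G_def e_def theta_term_2_5_add_1[OF q(1)] by (simp only: ip1 b_def t_def)
    qed
    have "(1 - M ^ 2 * q ^ 3) * (1 - M ^ 2) * P * (e r * (q powi r) ^ 2 * ip (m - r) * ip (m + 1 + r))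
        - (1 + M) * (P * (e r * (q powi r) ^ 2 * ip (m - 1 - r) * ip (m + r)))
        + q * M * ((1 - M ^ 2) * P * (e r * ip (m - r) * ip (m + r)))
      = P * (e r * a * b) * ((1 - M ^ 2 * q ^ 3) * (1 - M ^ 2) * t ^ 2
          - (1 + M) * (t ^ 2 * (1 - M / t ^ 3) * (1 - M * q ^ 3 * t ^ 3))
          + q * M * ((1 - M ^ 2) * (1 - M * q ^ 3 * t ^ 3)))"
      unfolding ip1 ip2 a_def[symmetric] b_def[symmetric] t_def[symmetric] by algebra
    also have "\<dots> = P * (e r * a * b) * (M * (1 + M) * (f t * (1 - M * q ^ 3 * t ^ 3)
         + q ^ 2 * t ^ 5 * f (q * t) * (1 - M / t ^ 3) + (M * (q * t + q ^ 3 * t ^ 5) - t ^ 2 - q * t ^ 4)))"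
      unfolding f_def by (simp only: rr_odd_Suc_identity[OF q(1) t])
    also have "\<dots> = P * M * (1 + M) * (G r - G (r + 1) + F r)"
      unfolding G G' F_def a_def[symmetric] b_def[symmetric] t_def[symmetric] by algebra
    finally show ?thesis .
  qed
  then have "(\<Sum>r = - N..N. (1 - M ^ 2 * q ^ 3) * (1 - M ^ 2) * P * (e r * (q powi r) ^ 2 * ip (m - r) * ip (m + 1 + r))
      - (1 + M) * (P * (e r * (q powi r) ^ 2 * ip (m - 1 - r) * ip (m + r)))
      + q * M * ((1 - M ^ 2) * P * (e r * ip (m - r) * ip (m + r))))
     = P * M * (1 + M) * ((\<Sum>r = - N..N. G r) - (\<Sum>r = - N..N. G (r + 1)) + (\<Sum>r = - N..N. F r))"
    by (simp only: sum.distrib sum_subtractf sum_distrib_left[symmetric])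
  then have "(1 - M ^ 2 * q ^ 3) * (1 - M ^ 2) * P * (\<Sum>r = - N..N. e r * (q powi r) ^ 2 * ip (m - r) * ip (m + 1 + r))
      - (1 + M) * (P * (\<Sum>r = - N..N. e r * (q powi r) ^ 2 * ip (m - 1 - r) * ip (m + r)))
      + q * M * ((1 - M ^ 2) * P * (\<Sum>r = - N..N. e r * ip (m - r) * ip (m + r))) = 0"
    unfolding F0 G0 by (simp only: sum.distrib sum_subtractf sum_distrib_left[symmetric]) simp
  moreover have "rr_even q N (Suc n) = (1 - M ^ 2) * P * (\<Sum>r = - N..N. e r * ip (m - r) * ip (m + r))"
    unfolding rr_even_def p1 by (simp only: e_def ip_def m_def)
  moreover have "rr_odd q N n = P * (\<Sum>r = - N..N. e r * (q powi r) ^ 2 * ip (m - 1 - r) * ip (m + r))"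
    unfolding rr_odd_def theta_term_4_5 by (simp add: P_def e_def ip_def m_def add.commute)
  moreover have "rr_odd q N (Suc n) = (1 - M ^ 2 * q ^ 3) * (1 - M ^ 2) * P *
      (\<Sum>r = - N..N. e r * (q powi r) ^ 2 * ip (m - r) * ip (m + 1 + r))"
    unfolding rr_odd_def p2 theta_term_4_5 by (simp only: e_def ip_def m_def)
  ultimately have "rr_odd q N (Suc n) - (1 + M) * rr_odd q N n + q * M * rr_even q N (Suc n) = 0"
    by (simp only:)
  then show ?thesis
    unfolding p4 by (simp add: M_def algebra_simps)
qed

section \<open>Recurrences for sums of Gaussian trinomial coefficients\<close>

text \<open>\<open>x\<close> and \<open>y\<close> stay free because the recurrences move them by
  powers of \<open>q\<close>. They carry both the twist and the linear part of the exponent: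
  \<open>x = w / q ^ 2\<close>, \<open>y = w ^ 2 / q\<close> yields the twisted summand of
  \<open>S3\<close>.\<close>

definition trinomial_term :: "complex \<Rightarrow> nat \<Rightarrow> complex \<Rightarrow> complex \<Rightarrow> nat \<Rightarrow> nat \<Rightarrow> complex" where
  "trinomial_term q n x y i j = x ^ i * y ^ j * q ^ (2 * i\<^sup>2 + 2 * i * j + 2 * j\<^sup>2)
     * inv_qpoch (q ^ 3) (int i) * inv_qpoch (q ^ 3) (int j) * inv_qpoch (q ^ 3) (int n - int i - int j)"

text \<open>Again \<open>N\<close> is only a cutoff, without effect for \<open>N \<ge> n\<close>.\<close>
definition trinomial_sum :: "complex \<Rightarrow> nat \<Rightarrow> nat \<Rightarrow> complex \<Rightarrow> complex \<Rightarrow> complex" where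
  "trinomial_sum q N n x y = qpoch (q ^ 3) (q ^ 3) n * (\<Sum>i\<le>N. \<Sum>j\<le>N. trinomial_term q n x y i j)"

lemma trinomial_term_eq_0: "i + j > n \<Longrightarrow> trinomial_term q n x y i j = 0"
  by (simp add: trinomial_term_def)

lemma trinomial_term_swap: "trinomial_term q n x y i j = trinomial_term q n y x j i"
  by (simp add: trinomial_term_def algebra_simps)

lemma trinomial_sum_swap: "trinomial_sum q N n x y = trinomial_sum q N n y x"
  unfolding trinomial_sum_def by (subst sum.swap) (subst trinomial_term_swap, rule refl)

lemma sum_atMost_shift:
  fixes f :: "nat \<Rightarrow> 'a :: comm_monoid_add"
  assumes "f 0 = 0" "f (Suc N) = 0"
  shows "(\<Sum>i\<le>N. f i) = (\<Sum>i\<le>N. f (Suc i))"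
proof -
  have "(\<Sum>i\<le>N. f i) = (\<Sum>i\<le>Suc N. f i)"
    using assms by simp
  also have "\<dots> = (\<Sum>i\<le>N. f (Suc i))"
    by (subst sum.atMost_Suc_shift) (simp add: assms)
  finally show ?thesis .
qed

lemma quadratic_exponent_Suc:
  "2 * (Suc i)\<^sup>2 + 2 * Suc i * j + 2 * j\<^sup>2 = (2 * i\<^sup>2 + 2 * i * j + 2 * j\<^sup>2) + 4 * i + 2 * j + (2 :: nat)"
  by (simp add: power2_eq_square algebra_simps)

text \<open>The factor cancels the last factor of the Pochhammer symbol at \<open>Suc i\<close>. The
  quadratic exponent grows by 4i + 2j + 2, which is absorbed into \<open>x\<close>, \<open>y\<close>
  and the prefactor.\<close>

lemma trinomial_term_Suc_1:
  assumes "norm q < 1"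
  shows "(1 - (q ^ 3) ^ Suc i) * trinomial_term q (Suc n) x y (Suc i) j =
    x * q ^ 2 * trinomial_term q n (x * q ^ 4) (y * q ^ 2) i j"
proof -
  have Q: "norm (q ^ 3) < 1"
    using assms by (simp add: norm_power power_less_one_iff)
  have ip: "(1 - (q ^ 3) ^ Suc i) * inv_qpoch (q ^ 3) (int (Suc i)) = inv_qpoch (q ^ 3) (int i)"
    using inv_qpoch_diff_1[OF Q, of "int (Suc i)"] unfolding power_int_of_nat by simp
  have "int (Suc n) - int (Suc i) - int j = int n - int i - int j"
    by simp
  then have "(1 - (q ^ 3) ^ Suc i) * trinomial_term q (Suc n) x y (Suc i) j =
    x ^ Suc i * y ^ j * q ^ (2 * (Suc i)\<^sup>2 + 2 * Suc i * j + 2 * j\<^sup>2) *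
    ((1 - (q ^ 3) ^ Suc i) * inv_qpoch (q ^ 3) (int (Suc i))) * inv_qpoch (q ^ 3) (int j)
    * inv_qpoch (q ^ 3) (int n - int i - int j)"
    unfolding trinomial_term_def by (simp only: mult_ac)
  also have "\<dots> = x * q ^ 2 * trinomial_term q n (x * q ^ 4) (y * q ^ 2) i j"
    unfolding ip trinomial_term_def quadratic_exponent_Suc power_add power_mult[of q 4] power_mult[of q 2 j]
    by (simp add: power_mult_distrib mult_ac)
  finally show ?thesis .
qed

lemma qpoch_cube_Suc: "qpoch (q ^ 3) (q ^ 3) (Suc n) = (1 - q ^ (3 * n + 3)) * qpoch (q ^ 3) (q ^ 3) n"
  by (simp add: qpoch_Suc power_add mult_ac flip: power_mult)

text \<open>Replacing \<open>x\<close> by \<open>x * q ^ 3\<close> inserts Q^i, so the difference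
  carries 1 - Q^i. This kills the row \<open>i = 0\<close> and allows an index shift.\<close>

lemma trinomial_sum_diff_left:
  assumes "norm q < 1" "n < N"
  shows "trinomial_sum q N (Suc n) x y - trinomial_sum q N (Suc n) (x * q ^ 3) y =
    x * q ^ 2 * (1 - q ^ (3 * n + 3)) * trinomial_sum q N n (x * q ^ 4) (y * q ^ 2)"
proof -
  define f where "f = (\<lambda>i. \<Sum>j\<le>N. (1 - (q ^ 3) ^ i) * trinomial_term q (Suc n) x y i j)"
  have "trinomial_term q (Suc n) x y i j - trinomial_term q (Suc n) (x * q ^ 3) y i j
      = (1 - (q ^ 3) ^ i) * trinomial_term q (Suc n) x y i j" for i j
    by (simp add: trinomial_term_def power_mult_distrib algebra_simps)
  then have "(\<Sum>i\<le>N. \<Sum>j\<le>N. trinomial_term q (Suc n) x y i j) - (\<Sum>i\<le>N. \<Sum>j\<le>N. trinomial_term q (Suc n) (x * q ^ 3) y i j)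
      = (\<Sum>i\<le>N. f i)"
    by (simp add: f_def flip: sum_subtractf)
  also have "\<dots> = (\<Sum>i\<le>N. f (Suc i))"
    by (rule sum_atMost_shift) (use assms in \<open>auto simp: f_def trinomial_term_eq_0\<close>)
  also have "\<dots> = x * q ^ 2 * (\<Sum>i\<le>N. \<Sum>j\<le>N. trinomial_term q n (x * q ^ 4) (y * q ^ 2) i j)"
    unfolding f_def trinomial_term_Suc_1[OF assms(1)] by (simp add: sum_distrib_left)
  finally have *: "(\<Sum>i\<le>N. \<Sum>j\<le>N. trinomial_term q (Suc n) x y i j) - (\<Sum>i\<le>N. \<Sum>j\<le>N. trinomial_term q (Suc n) (x * q ^ 3) y i j)
      = x * q ^ 2 * (\<Sum>i\<le>N. \<Sum>j\<le>N. trinomial_term q n (x * q ^ 4) (y * q ^ 2) i j)" .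
  show ?thesis
    unfolding trinomial_sum_def right_diff_distrib[symmetric] * qpoch_cube_Suc by (simp only: mult_ac)
qed

lemma powi_cube_diff:
  fixes q :: complex
  assumes "q \<noteq> 0"
  shows "(q ^ 3) powi (int n - int i - int j) = (q ^ 3) ^ n / ((q ^ 3) ^ i * (q ^ 3) ^ j)"
  using assms by (simp add: power_int_diff)

lemma trinomial_term_Suc_3:
  assumes "norm q < 1" "q \<noteq> 0"
  shows "trinomial_term q n x y i j =
    (1 - (q ^ 3) ^ Suc n / ((q ^ 3) ^ i * (q ^ 3) ^ j)) * trinomial_term q (Suc n) x y i j"
proof -
  have Q: "norm (q ^ 3) < 1"
    using assms by (simp add: norm_power power_less_one_iff)
  define l where "l = int (Suc n) - int i - int j"
  have "int n - int i - int j = l - 1"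
    by (simp add: l_def)
  moreover have "inv_qpoch (q ^ 3) (l - 1) = (1 - (q ^ 3) ^ Suc n / ((q ^ 3) ^ i * (q ^ 3) ^ j)) * inv_qpoch (q ^ 3) l"
    unfolding inv_qpoch_diff_1[OF Q] l_def powi_cube_diff[OF assms(2)] ..
  ultimately show ?thesis
    unfolding trinomial_term_def l_def[symmetric] by simp
qed

text \<open>Dividing \<open>x\<close> and \<open>y\<close> by \<open>q ^ 3\<close> inserts Q^(-i-j).
  The difference therefore carries 1 - Q^(n+1-i-j), which lowers the third index of the trinomial
  coefficient.\<close>

lemma trinomial_sum_diff_both:
  assumes "norm q < 1" "q \<noteq> 0"
  shows "trinomial_sum q N (Suc n) x y - q ^ (3 * n + 3) * trinomial_sum q N (Suc n) (x / q ^ 3) (y / q ^ 3) =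
    (1 - q ^ (3 * n + 3)) * trinomial_sum q N n x y"
proof -
  have "trinomial_term q (Suc n) x y i j - q ^ (3 * n + 3) * trinomial_term q (Suc n) (x / q ^ 3) (y / q ^ 3) i j
      = trinomial_term q n x y i j" for i j
  proof -
    have "q ^ (3 * n + 3) = (q ^ 3) ^ Suc n"
      by (simp add: power_add flip: power_mult)
    moreover have "trinomial_term q (Suc n) (x / q ^ 3) (y / q ^ 3) i j
        = trinomial_term q (Suc n) x y i j / ((q ^ 3) ^ i * (q ^ 3) ^ j)"
      by (simp add: trinomial_term_def power_divide)
    ultimately show ?thesis
      unfolding trinomial_term_Suc_3[OF assms, of n] by (simp add: algebra_simps)
  qed
  then have *: "(\<Sum>i\<le>N. \<Sum>j\<le>N. trinomial_term q (Suc n) x y i j) - q ^ (3 * n + 3) *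
      (\<Sum>i\<le>N. \<Sum>j\<le>N. trinomial_term q (Suc n) (x / q ^ 3) (y / q ^ 3) i j)
      = (\<Sum>i\<le>N. \<Sum>j\<le>N. trinomial_term q n x y i j)"
    by (simp add: sum_distrib_left flip: sum_subtractf)
  show ?thesis
    unfolding trinomial_sum_def mult.left_commute[of "q ^ (3 * n + 3)"] right_diff_distrib[symmetric] *
      qpoch_cube_Suc by (simp only: mult_ac)
qed

text \<open>A Q-Pascal rule: with R = Q^(n+1), the factor 1 - R splits as (1 - R Q^(-i-j)) + R
  Q^(-i-j) (1 - Q^i) + R Q^(-j) (1 - Q^j), and each summand lowers one of the three indices.\<close>

lemma trinomial_sum_Suc:
  assumes "norm q < 1" "q \<noteq> 0" "n < N"
  shows "trinomial_sum q N (Suc n) x y = trinomial_sum q N n x y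
    + x * q ^ (3 * n + 2) * trinomial_sum q N n (x * q) (y / q)
    + y * q ^ (3 * n + 2) * trinomial_sum q N n (x * q ^ 2) (y * q)"
proof -
  define R where "R = (q ^ 3) ^ Suc n"
  define f where "f = (\<lambda>i. \<Sum>j\<le>N. R / ((q ^ 3) ^ i * (q ^ 3) ^ j) * ((1 - (q ^ 3) ^ i) * trinomial_term q (Suc n) x y i j))"
  \<comment> \<open>The arguments are written in swapped order so that
    \<open>trinomial_term_Suc_1\<close> also serves for the index \<open>j\<close>.\<close>
  define g where "g = (\<lambda>j. \<Sum>i\<le>N. R / (q ^ 3) ^ j * ((1 - (q ^ 3) ^ j) * trinomial_term q (Suc n) y x j i))"
  have *: "(1 - R) * trinomial_term q (Suc n) x y i j = trinomial_term q n x y i j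
      + R / ((q ^ 3) ^ i * (q ^ 3) ^ j) * ((1 - (q ^ 3) ^ i) * trinomial_term q (Suc n) x y i j)
      + R / (q ^ 3) ^ j * ((1 - (q ^ 3) ^ j) * trinomial_term q (Suc n) y x j i)" for i j
  proof -
    have "trinomial_term q n x y i j = (1 - R / ((q ^ 3) ^ i * (q ^ 3) ^ j)) * trinomial_term q (Suc n) x y i j"
      unfolding R_def by (rule trinomial_term_Suc_3[OF assms(1,2)])
    moreover have "trinomial_term q (Suc n) y x j i = trinomial_term q (Suc n) x y i j"
      by (rule trinomial_term_swap)
    ultimately show ?thesis
      using assms(2) by (simp add: field_simps)
  qed
  have "(1 - R) * (\<Sum>i\<le>N. \<Sum>j\<le>N. trinomial_term q (Suc n) x y i j) =
    (\<Sum>i\<le>N. \<Sum>j\<le>N. trinomial_term q n x y i j) + (\<Sum>i\<le>N. f i) + (\<Sum>j\<le>N. g j)"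
    unfolding sum_distrib_left * f_def g_def sum.distrib by (subst (3) sum.swap) simp
  also have "(\<Sum>i\<le>N. f i) = (\<Sum>i\<le>N. f (Suc i))"
    by (rule sum_atMost_shift) (use assms in \<open>auto simp: f_def trinomial_term_eq_0\<close>)
  also have "\<dots> = x * q ^ (3 * n + 2) * (\<Sum>i\<le>N. \<Sum>j\<le>N. trinomial_term q n (x * q) (y / q) i j)"
  proof -
    have "R / ((q ^ 3) ^ Suc i * (q ^ 3) ^ j) * (x * q ^ 2 * trinomial_term q n (x * q ^ 4) (y * q ^ 2) i j)
        = x * q ^ (3 * n + 2) * trinomial_term q n (x * q) (y / q) i j" for i j
    proof -
      have "(q ^ 4) ^ i = (q ^ 3) ^ i * q ^ i" "(q ^ 2) ^ j * q ^ j = (q ^ 3) ^ j"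
        by (simp_all flip: power_mult_distrib power_Suc power_Suc2 power_add)
      moreover have "R = q ^ (3 * n) * q ^ 3" "q ^ (3 * n + 2) = q ^ (3 * n) * q ^ 2"
        by (simp_all add: R_def power_mult power_add power2_eq_square)
      ultimately show ?thesis
        using assms(2) unfolding trinomial_term_def
        by (simp add: power_mult_distrib power_divide divide_simps)
    qed
    then show ?thesis
      unfolding f_def trinomial_term_Suc_1[OF assms(1)] sum_distrib_left by simp
  qed
  also have "(\<Sum>j\<le>N. g j) = (\<Sum>j\<le>N. g (Suc j))"
    by (rule sum_atMost_shift) (use assms in \<open>auto simp: g_def trinomial_term_eq_0\<close>)
  also have "\<dots> = y * q ^ (3 * n + 2) * (\<Sum>i\<le>N. \<Sum>j\<le>N. trinomial_term q n (x * q ^ 2) (y * q) i j)"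
  proof -
    have "R / (q ^ 3) ^ Suc j * (y * q ^ 2 * trinomial_term q n (y * q ^ 4) (x * q ^ 2) j i)
        = y * q ^ (3 * n + 2) * trinomial_term q n (x * q ^ 2) (y * q) i j" for i j
    proof -
      have "(q ^ 4) ^ j = (q ^ 3) ^ j * q ^ j"
        by (simp flip: power_mult_distrib power_Suc2)
      moreover have "R = q ^ (3 * n) * q ^ 3" "q ^ (3 * n + 2) = q ^ (3 * n) * q ^ 2"
        by (simp_all add: R_def power_mult power_add power2_eq_square)
      ultimately show ?thesis
        using assms(2) unfolding trinomial_term_swap[of q n "x * q ^ 2"] unfolding trinomial_term_def
        by (simp add: power_mult_distrib power_divide divide_simps)
    qed
    then show ?thesis
      unfolding g_def trinomial_term_Suc_1[OF assms(1)] sum_distrib_left by (subst sum.swap) simp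
  qed
  finally have "(1 - R) * (\<Sum>i\<le>N. \<Sum>j\<le>N. trinomial_term q (Suc n) x y i j) =
    (\<Sum>i\<le>N. \<Sum>j\<le>N. trinomial_term q n x y i j)
    + x * q ^ (3 * n + 2) * (\<Sum>i\<le>N. \<Sum>j\<le>N. trinomial_term q n (x * q) (y / q) i j)
    + y * q ^ (3 * n + 2) * (\<Sum>i\<le>N. \<Sum>j\<le>N. trinomial_term q n (x * q ^ 2) (y * q) i j)" .
  moreover have "qpoch (q ^ 3) (q ^ 3) (Suc n) = qpoch (q ^ 3) (q ^ 3) n * (1 - R)"
    by (simp add: qpoch_Suc R_def)
  ultimately show ?thesis
    unfolding trinomial_sum_def by (simp add: mult.assoc) (simp add: algebra_simps)
qed

lemma trinomial_sum_0 [simp]: "trinomial_sum q N 0 x y = 1"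
proof -
  have "(\<Sum>j\<le>N. trinomial_term q 0 x y i j) = (if i = 0 then 1 else 0)" for i
  proof -
    have "(\<Sum>j\<le>N. trinomial_term q 0 x y i j) = (\<Sum>j\<le>N. if j = 0 then (if i = 0 then 1 else 0) else 0)"
      by (intro sum.cong refl) (auto simp: trinomial_term_def)
    then show ?thesis
      by simp
  qed
  then show ?thesis
    by (simp add: trinomial_sum_def)
qed

section \<open>Specialisation at a primitive cube root of unity\<close>

context
  fixes q w :: complex and N :: nat
  assumes q: "norm q < 1" "q \<noteq> 0" and w: "w ^ 2 + w + 1 = 0"
begin

lemma omega_cube: "w ^ 3 = 1"
  using w by algebra

text \<open>The shifts of \<open>trinomial_sum_Suc\<close> send the first specialisation to the
  second one and to \<open>(w, w ^ 2)\<close>. The second, read with swapped arguments, is the first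
  with \<open>w\<close> and \<open>w ^ 2\<close> interchanged, hence behaves alike.\<close>

lemma trinomial_sum_omega_Suc:
  assumes "n < N"
  shows "trinomial_sum q N (Suc n) (w / q ^ 2) (w ^ 2 / q) = trinomial_sum q N n (w / q ^ 2) (w ^ 2 / q)
      + w * q ^ (3 * n) * trinomial_sum q N n (w / q) (w ^ 2 / q ^ 2)
      + w ^ 2 * q ^ (3 * n + 1) * trinomial_sum q N n w (w ^ 2)" (is ?A)
    and "trinomial_sum q N (Suc n) (w / q) (w ^ 2 / q ^ 2) = trinomial_sum q N n (w / q) (w ^ 2 / q ^ 2)
      + w ^ 2 * q ^ (3 * n) * trinomial_sum q N n (w / q ^ 2) (w ^ 2 / q)
      + w * q ^ (3 * n + 1) * trinomial_sum q N n w (w ^ 2)" (is ?B)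
proof -
  have eqs: "x / q ^ 2 * q ^ (3 * n + 2) = x * q ^ (3 * n)" "x / q * q ^ (3 * n + 2) = x * q ^ (3 * n + 1)"
    "x / q ^ 2 * q = x / q" "x / q / q = x / q ^ 2" "x / q ^ 2 * q ^ 2 = x" "x / q * q = x" for x
    using q by (simp_all add: power_add power2_eq_square)
  show ?A
    using trinomial_sum_Suc[OF q assms, of "w / q ^ 2" "w ^ 2 / q"] unfolding eqs .
  have "trinomial_sum q N (Suc n) (w ^ 2 / q ^ 2) (w / q) = trinomial_sum q N n (w ^ 2 / q ^ 2) (w / q)
      + w ^ 2 * q ^ (3 * n) * trinomial_sum q N n (w ^ 2 / q) (w / q ^ 2)
      + w * q ^ (3 * n + 1) * trinomial_sum q N n (w ^ 2) w"
    using trinomial_sum_Suc[OF q assms, of "w ^ 2 / q ^ 2" "w / q"] unfolding eqs .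
  then show ?B
    by (simp only: trinomial_sum_swap[of _ _ _ "w ^ 2 / q ^ 2"] trinomial_sum_swap[of _ _ _ "w ^ 2 / q"]
        trinomial_sum_swap[of _ _ _ "w ^ 2"])
qed

text \<open>The defect \<open>Y n - w ^ 2 * X n\<close> is multiplied by
  \<open>1 - q ^ (3 * n)\<close> at each step. This factor is 0 for \<open>n = 0\<close>, so the
  defect vanishes from index 1 on, although not at 0.\<close>

lemma trinomial_sum_omega_swap:
  assumes "Suc n \<le> N"
  shows "trinomial_sum q N (Suc n) (w / q) (w ^ 2 / q ^ 2) =
    w ^ 2 * trinomial_sum q N (Suc n) (w / q ^ 2) (w ^ 2 / q)"
proof -
  define X where "X = (\<lambda>n. trinomial_sum q N n (w / q ^ 2) (w ^ 2 / q))"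
  define Y where "Y = (\<lambda>n. trinomial_sum q N n (w / q) (w ^ 2 / q ^ 2))"
  have step: "Y (Suc n) - w ^ 2 * X (Suc n) = (1 - q ^ (3 * n)) * (Y n - w ^ 2 * X n)" if "n < N" for n
  proof -
    have "Y (Suc n) - w ^ 2 * X (Suc n) - (1 - q ^ (3 * n)) * (Y n - w ^ 2 * X n)
        = (1 - w ^ 3) * (q ^ (3 * n) * Y n + w * q ^ (3 * n + 1) * trinomial_sum q N n w (w ^ 2))"
      unfolding X_def Y_def trinomial_sum_omega_Suc[OF that] by algebra
    then show ?thesis
      by (simp add: omega_cube)
  qed
  have "Y (Suc n) - w ^ 2 * X (Suc n) = 0" if "Suc n \<le> N" for n
    using that
  proof (induction n)
    case 0
    then show ?case
      using step[of 0] by simp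
  next
    case (Suc n)
    then show ?case
      using step[of "Suc n"] by simp
  qed
  from this[OF assms] show ?thesis
    by (simp add: X_def Y_def)
qed

text \<open>Eliminates the two new specialisations that \<open>trinomial_sum_Suc\<close> creates
  from \<open>(w, w ^ 2)\<close>. The two difference equations used have right-hand sides
  proportional to the same sum at \<open>(w * q ^ 2, w ^ 2 * q)\<close>, which cancels.\<close>

lemma trinomial_sum_omega_middle:
  assumes "n \<le> N"
  shows "w * trinomial_sum q N n (w * q) (w ^ 2 / q) + w ^ 2 * trinomial_sum q N n (w * q ^ 2) (w ^ 2 * q) =
    w * trinomial_sum q N n (w / q ^ 2) (w ^ 2 / q) + w ^ 2 * q ^ (3 * n) * trinomial_sum q N n (w / q) (w ^ 2 / q ^ 2)"
proof (cases n)
  case (Suc k)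
  have "w / q ^ 2 * q ^ 3 = w * q" "w / q ^ 2 * q ^ 2 = w" "w / q ^ 2 * q ^ 4 = w * q ^ 2" "w ^ 2 / q * q ^ 2 = w ^ 2 * q"
    using q by (simp_all add: divide_simps power_numeral_reduce)
  then have 1: "trinomial_sum q N (Suc k) (w / q ^ 2) (w ^ 2 / q) - trinomial_sum q N (Suc k) (w * q) (w ^ 2 / q) =
      w * (1 - q ^ (3 * k + 3)) * trinomial_sum q N k (w * q ^ 2) (w ^ 2 * q)"
    using trinomial_sum_diff_left[OF q(1), of k N "w / q ^ 2" "w ^ 2 / q"] assms Suc by simp
  have "w * q ^ 2 / q ^ 3 = w / q" "w ^ 2 * q / q ^ 3 = w ^ 2 / q ^ 2"
    using q by (simp_all add: divide_simps power_numeral_reduce)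
  then have 2: "trinomial_sum q N (Suc k) (w * q ^ 2) (w ^ 2 * q)
      - q ^ (3 * k + 3) * trinomial_sum q N (Suc k) (w / q) (w ^ 2 / q ^ 2) =
      (1 - q ^ (3 * k + 3)) * trinomial_sum q N k (w * q ^ 2) (w ^ 2 * q)"
    using trinomial_sum_diff_both[OF q, of N k "w * q ^ 2" "w ^ 2 * q"] by simp
  have *: "3 * Suc k = 3 * k + 3"
    by simp
  have linear: "w * B + w ^ 2 * D = w * A + w ^ 2 * R * C" if "A - B = w * p * T" "D - R * C = p * T" for A B C D R T p
    using that by algebra
  show ?thesis
    unfolding Suc * by (rule linear[OF 1 2])
qed simp

lemma trinomial_sum_omega_Suc':
  assumes "n < N"
  shows "trinomial_sum q N (Suc n) w (w ^ 2) = (1 - q ^ (6 * n + 3)) * trinomial_sum q N n w (w ^ 2)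
    + w * q ^ (3 * n + 2) * trinomial_sum q N (Suc n) (w / q ^ 2) (w ^ 2 / q)"
proof -
  define U where "U = trinomial_sum q N n w (w ^ 2)"
  define X where "X = trinomial_sum q N n (w / q ^ 2) (w ^ 2 / q)"
  define Y where "Y = trinomial_sum q N n (w / q) (w ^ 2 / q ^ 2)"
  have *: "q ^ (3 * n + 2) * q ^ (3 * n + 1) = q ^ (6 * n + 3)"
    unfolding power_add[symmetric] by (rule arg_cong[where f = "\<lambda>k. q ^ k"]) simp
  have "trinomial_sum q N (Suc n) w (w ^ 2) = U + q ^ (3 * n + 2) *
     (w * trinomial_sum q N n (w * q) (w ^ 2 / q) + w ^ 2 * trinomial_sum q N n (w * q ^ 2) (w ^ 2 * q))"
    unfolding trinomial_sum_Suc[OF q assms] U_def by (simp add: algebra_simps)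
  also have "\<dots> = U + q ^ (3 * n + 2) * (w * X + w ^ 2 * q ^ (3 * n) * Y)"
    using trinomial_sum_omega_middle[of n] assms by (simp add: X_def Y_def)
  \<comment> \<open>Adding and subtracting a multiple of \<open>U\<close> completes the last bracket
    to the recurrence for the first specialisation at \<open>Suc n\<close>.\<close>
  also have "\<dots> = U - w ^ 3 * (q ^ (3 * n + 2) * q ^ (3 * n + 1)) * U
      + w * q ^ (3 * n + 2) * (X + w * q ^ (3 * n) * Y + w ^ 2 * q ^ (3 * n + 1) * U)"
    by algebra
  also have "\<dots> = (1 - q ^ (6 * n + 3)) * U + w * q ^ (3 * n + 2) * trinomial_sum q N (Suc n) (w / q ^ 2) (w ^ 2 / q)"
    unfolding trinomial_sum_omega_Suc[OF assms] U_def[symmetric] X_def[symmetric] Y_def[symmetric]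
    unfolding *  by (simp add: omega_cube algebra_simps)
  finally show ?thesis
    by (simp add: U_def)
qed

text \<open>Induction along the two coupled recurrences. The second specialisation is taken at
  \<open>Suc n\<close> because the proportionality of \<open>trinomial_sum_omega_swap\<close> starts
  only at index 1; the constant \<open>- (w ^ 2)\<close> comes from 1 + w = - w^2 in the base
  case.\<close>

lemma trinomial_sum_omega_eq_rr:
  assumes "Suc n \<le> N" "int n + 2 \<le> K"
  shows "trinomial_sum q N n w (w ^ 2) = rr_even q K n \<and>
    trinomial_sum q N (Suc n) (w / q ^ 2) (w ^ 2 / q) = - (w ^ 2) * rr_odd q K n"
  using assms
proof (induction n)
  case 0
  have "1 + w + w ^ 2 * q = - (w ^ 2) * (1 - q)"
    using w by algebra
  then show ?case
    using 0 trinomial_sum_omega_Suc(1)[of 0] by (simp add: rr_even_0 rr_odd_0 q)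
next
  case (Suc n)
  define E where "E = rr_even q K"
  define D where "D = rr_odd q K"
  from Suc have IH: "trinomial_sum q N n w (w ^ 2) = E n"
      "trinomial_sum q N (Suc n) (w / q ^ 2) (w ^ 2 / q) = - (w ^ 2) * D n"
    by (auto simp: E_def D_def)
  have E: "E (Suc n) = (1 - q ^ (6 * n + 3)) * E n - q ^ (3 * n + 2) * D n"
    unfolding E_def D_def using Suc q by (intro rr_even_Suc) auto
  have D: "D (Suc n) = (1 + q ^ (3 * n + 3)) * D n - q ^ (3 * n + 4) * E (Suc n)"
    unfolding E_def D_def using Suc q by (intro rr_odd_Suc) auto
  have U: "trinomial_sum q N (Suc n) w (w ^ 2) = (1 - q ^ (6 * n + 3)) * E n + w * q ^ (3 * n + 2) * (- (w ^ 2) * D n)"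
    using trinomial_sum_omega_Suc'[of n] Suc IH by simp
  have "w * q ^ (3 * n + 2) * (- (w ^ 2) * D n) = - (w ^ 3) * q ^ (3 * n + 2) * D n"
    by algebra
  then have 1: "trinomial_sum q N (Suc n) w (w ^ 2) = E (Suc n)"
    unfolding U E by (simp add: omega_cube)
  have Y: "trinomial_sum q N (Suc n) (w / q) (w ^ 2 / q ^ 2) = w ^ 2 * (- (w ^ 2) * D n)"
    using trinomial_sum_omega_swap[of n] Suc IH by simp
  have "trinomial_sum q N (Suc (Suc n)) (w / q ^ 2) (w ^ 2 / q) = - (w ^ 2) * D n
      + w * q ^ (3 * Suc n) * (w ^ 2 * (- (w ^ 2) * D n)) + w ^ 2 * q ^ (3 * Suc n + 1) * E (Suc n)"
    using trinomial_sum_omega_Suc(1)[of "Suc n"] Suc.prems unfolding Y IH(2) 1 by simp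
  also have "\<dots> = - (w ^ 2) * ((1 + w ^ 3 * q ^ (3 * Suc n)) * D n - q ^ (3 * Suc n + 1) * E (Suc n))"
    by algebra
  also have "\<dots> = - (w ^ 2) * D (Suc n)"
    unfolding D omega_cube by (simp add: add.commute)
  finally show ?case
    using 1 by (simp add: E_def D_def)
qed

end

section \<open>Jacobi's triple product\<close>

lemma abs_summable_on_int_geometric:
  fixes s :: real
  assumes "0 \<le> s" "s < 1"
  shows "(\<lambda>r :: int. s ^ nat \<bar>r\<bar>) summable_on UNIV"
proof -
  have 0: "(\<lambda>n :: nat. s ^ n) summable_on UNIV"
    using assms by (subst summable_on_UNIV_nonneg_real_iff) (auto intro: summable_geometric)
  have inj: "inj int" "inj (\<lambda>n. - int n)"
    by (simp_all add: inj_def)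
  have "(\<lambda>r :: int. s ^ nat \<bar>r\<bar>) summable_on range int"
    unfolding summable_on_reindex[OF inj(1)] o_def using 0 by simp
  moreover have "(\<lambda>r :: int. s ^ nat \<bar>r\<bar>) summable_on range (\<lambda>n. - int n)"
    unfolding summable_on_reindex[OF inj(2)] o_def using 0 by simp
  ultimately have "(\<lambda>r :: int. s ^ nat \<bar>r\<bar>) summable_on range int \<union> range (\<lambda>n. - int n)"
    by (rule summable_on_union)
  also have "range int \<union> range (\<lambda>n. - int n) = UNIV"
  proof -
    have "r \<in> range int \<union> range (\<lambda>n. - int n)" for r
      by (cases r rule: int_cases2) auto
    then show ?thesis
      by blast
  qed
  finally show ?thesis .
qed

text \<open>For r >= 0 the term is at most |z|^r. For r = -k the triangular exponent contains an
  extra k, which combines with z^(-k) to (q/z)^k. Hence both tails are geometric inside the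
  annulus.\<close>

lemma theta_term_summable:
  assumes "q \<noteq> 0" "norm q < norm z" "norm z < 1"
  shows "(\<lambda>r. norm (theta_term z q r)) summable_on UNIV"
proof -
  define s where "s = max (norm z) (norm q / norm z)"
  have z: "norm z > 0"
    using assms by (metis norm_ge_zero order_le_less_trans)
  have s: "0 \<le> s" "s < 1" "norm z \<le> s" "norm q / norm z \<le> s"
    using assms z by (auto simp: s_def divide_less_eq le_max_iff_disj)
  have tri: "r * (r - 1) div 2 \<ge> 0" for r :: int
  proof -
    have "r * (r - 1) \<ge> 0"
      by (cases "r \<le> 0") (auto intro: mult_nonneg_nonneg mult_nonpos_nonpos)
    then show ?thesis
      by simp
  qed
  have le: "norm (theta_term z q r) \<le> s ^ nat \<bar>r\<bar>" for r
  proof (cases "r \<ge> 0")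
    case True
    have "norm (theta_term z q r) = norm z ^ nat r * norm q ^ nat (r * (r - 1) div 2)"
      unfolding theta_term_def using True tri[of r]
      by (simp add: norm_mult norm_power power_int_nonneg_exp)
    also have "\<dots> \<le> s ^ nat r * 1"
      using s assms by (intro mult_mono power_mono power_le_one) auto
    finally show ?thesis
      using True by simp
  next
    case False
    define k where "k = nat (- r)"
    have r: "r = - int k"
      using False by (simp add: k_def)
    define m where "m = nat ((- r) * (- r - 1) div 2)"
    have "r * (r - 1) = (- r) * (- r - 1) + (- r) * 2"
      by (simp add: algebra_simps)
    then have "r * (r - 1) div 2 = (- r) * (- r - 1) div 2 + (- r)"
      by simp
    also have "\<dots> = int (m + k)"
      using tri[of "- r"] False by (simp add: m_def k_def)
    finally have *: "theta_term z q r = inverse ((- z) ^ k) * q ^ (m + k)"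
      unfolding theta_term_def by (simp only: power_int_of_nat) (simp add: r power_int_minus)
    have "norm (theta_term z q r) = (norm q / norm z) ^ k * norm q ^ m"
      unfolding * by (simp add: norm_mult norm_power norm_inverse power_add power_divide divide_inverse power_mult_distrib power_inverse)
    also have "\<dots> \<le> s ^ k * 1"
      using s assms by (intro mult_mono power_mono power_le_one) auto
    finally show ?thesis
      by (simp add: r)
  qed
  show ?thesis
    by (rule Infinite_Sum.abs_summable_on_comparison_test'[OF abs_summable_on_int_geometric[OF s(1,2)] le])
qed

text \<open>Each summand acquires two factors 1 / (q;q)_inf, one of which the prefactor cancels. The
  values \<open>d = 0\<close> and \<open>d = 1\<close> serve the even and odd binomial sums, and the
  range up to \<open>K n\<close> contains the whole support.\<close>

lemma bilateral_sum_LIMSEQ: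
  assumes q: "norm q < 1" and c: "(\<lambda>r. norm (c r)) summable_on UNIV"
    and a: "filterlim a at_top at_top" and K: "\<And>n. K n \<ge> int n + d" "d \<ge> 0"
  shows "(\<lambda>n. qpoch q q (a n) * (\<Sum>r = - K n..K n. c r * inv_qpoch q (int n - r) * inv_qpoch q (int n + d + r)))
     \<longlonglongrightarrow> (\<Sum>\<^sub>\<infinity>r. c r) / qpoch_inf q q"
proof -
  obtain B where B: "B > 0" "\<And>k. norm (inv_qpoch q k) \<le> B"
    using inv_qpoch_bounded[OF q] by blast
  define f where "f = (\<lambda>n r. c r * inv_qpoch q (int n - r) * inv_qpoch q (int n + d + r))"
  have "(\<lambda>n. \<Sum>\<^sub>\<infinity>r. f n r) \<longlonglongrightarrow> (\<Sum>\<^sub>\<infinity>r. c r * (1 / qpoch_inf q q) * (1 / qpoch_inf q q))"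
  proof (rule tendsto_infsum_dominated)
    show "norm (f n r) \<le> norm (c r) * (B * B)" for n r
      unfolding f_def norm_mult mult.assoc using B by (intro mult_mono) auto
    show "(\<lambda>r. norm (c r) * (B * B)) summable_on UNIV"
      by (rule summable_on_cmult_left[OF c])
    show "(\<lambda>n. f n r) \<longlonglongrightarrow> c r * (1 / qpoch_inf q q) * (1 / qpoch_inf q q)" for r
      unfolding f_def using inv_qpoch_LIMSEQ[OF q, of "- r"] inv_qpoch_LIMSEQ[OF q, of "d + r"]
      by (intro tendsto_mult tendsto_const) (simp_all add: algebra_simps)
  qed
  moreover have "(\<Sum>\<^sub>\<infinity>r. f n r) = (\<Sum>r = - K n..K n. f n r)" for n
  proof -
    have "(\<Sum>\<^sub>\<infinity>r. f n r) = (\<Sum>\<^sub>\<infinity>r\<in>{- K n..K n}. f n r)"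
      using K(1)[of n] K(2) by (intro infsum_cong_neutral) (auto simp: f_def not_le)
    then show ?thesis
      by simp
  qed
  moreover have "(\<lambda>n. qpoch q q (a n)) \<longlonglongrightarrow> qpoch_inf q q"
    by (rule filterlim_compose[OF qpoch_LIMSEQ[OF q] a])
  ultimately have "(\<lambda>n. qpoch q q (a n) * (\<Sum>r = - K n..K n. f n r)) \<longlonglongrightarrow>
     qpoch_inf q q * (\<Sum>\<^sub>\<infinity>r. c r * (1 / qpoch_inf q q) * (1 / qpoch_inf q q))"
    by (auto intro: tendsto_mult)
  also have "(\<Sum>\<^sub>\<infinity>r. c r * (1 / qpoch_inf q q) * (1 / qpoch_inf q q))
      = (\<Sum>\<^sub>\<infinity>r. c r) * (1 / qpoch_inf q q) * (1 / qpoch_inf q q)"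
    unfolding mult.assoc by (rule infsum_cmult_left')
  finally show ?thesis
    using qpoch_inf_neq_0[OF q] by (simp add: f_def)
qed

text \<open>The summand identity for the induction step below, after cancelling
  \<open>e r * ip (m - r) * ip (m + r)\<close>; the two brackets on the right come from the
  differences of \<open>G\<close> and \<open>H\<close>.\<close>

lemma finite_jacobi_identity:
  fixes M z q t :: complex
  assumes "z \<noteq> 0" "q \<noteq> 0" "t \<noteq> 0"
  shows "(1 - M ^ 2) * (1 - M ^ 2 / q) - (1 - z * M / q) * (1 - M / z) * ((1 - M / t) * (1 - M * t)) =
    (1 - z * M / q) * (M / z) * ((1 - M * t) + z * t * (1 - M / t))
    + (1 - M / z) * M * ((1 - M * t) / t + z / q * (1 - M / t))"
  using assms by (simp add: divide_simps) algebra

text \<open>Passing to \<open>Suc n\<close> multiplies the right side by (1 - z q^n)(1 - q^(n+1)/z),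
  written \<open>(1 - z * M / q) * (1 - M / z)\<close>. The corresponding difference on the left is
  a combination, with coefficients independent of \<open>r\<close>, of two telescoping
  differences.\<close>

lemma finite_jacobi_triple_product:
  assumes q: "q \<noteq> 0" "norm q < 1" and z: "z \<noteq> 0" and K: "int n \<le> K"
  shows "qpoch q q (2 * n) * (\<Sum>r = - K..K. theta_term z q r * inv_qpoch q (int n - r) * inv_qpoch q (int n + r))
     = qpoch z q n * qpoch (q / z) q n"
  using K
proof (induction n)
  case 0
  have "theta_term z q r * inv_qpoch q (int 0 - r) * inv_qpoch q (int 0 + r) = (if r = 0 then 1 else 0)" for r
    by (auto simp: theta_term_def inv_qpoch_def)
  then show ?case
    using 0 by simp
next
  case (Suc n)
  define e where "e = theta_term z q"
  define ip where "ip = inv_qpoch q"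
  define m where "m = int (Suc n)"
  define M where "M = q ^ Suc n"
  define P where "P = qpoch q q (2 * n)"
  define G where "G = (\<lambda>r. e r * ip (m - r) * ip (m - 1 + r))"
  define H where "H = (\<lambda>r. e r / q powi r * ip (m - r) * ip (m - 1 + r))"
  define S where "S = (\<Sum>r = - K..K. e r * ip (m - r) * ip (m + r))"
  define S' where "S' = (\<Sum>r = - K..K. e r * ip (m - 1 - r) * ip (m - 1 + r))"
  have "int n = m - 1"
    by (simp add: m_def)
  then have IH: "P * S' = qpoch z q n * qpoch (q / z) q n"
    using Suc by (simp add: P_def S'_def e_def ip_def)
  have G0: "(\<Sum>r = - K..K. G (r + 1)) = (\<Sum>r = - K..K. G r)"
    by (rule sum_int_shift) (use Suc.prems in \<open>auto simp: G_def ip_def m_def\<close>)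
  have H0: "(\<Sum>r = - K..K. H (r + 1)) = (\<Sum>r = - K..K. H r)"
    by (rule sum_int_shift) (use Suc.prems in \<open>auto simp: H_def ip_def m_def\<close>)
  have "(1 - M ^ 2) * (1 - M ^ 2 / q) * (e r * ip (m - r) * ip (m + r))
      - (1 - z * M / q) * (1 - M / z) * (e r * ip (m - 1 - r) * ip (m - 1 + r))
     = (1 - z * M / q) * (M / z) * (G r - G (r + 1)) + (1 - M / z) * M * (H r - H (r + 1))" for r
  proof -
    define t where "t = q powi r"
    define a where "a = ip (m - r)"
    define b where "b = ip (m + r)"
    have t: "t \<noteq> 0"
      using q by (simp add: t_def)
    have M: "q powi m = M"
      unfolding m_def M_def by (rule power_int_of_nat)
    have ip: "ip (k - 1) = (1 - q powi k) * ip k" for k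
      unfolding ip_def by (rule inv_qpoch_diff_1[OF q(2)])
    have ip1: "ip (m - 1 - r) = (1 - M / t) * a"
      using ip[of "m - r"] q by (simp add: power_int_diff M t_def a_def algebra_simps)
    have ip2: "ip (m - 1 + r) = (1 - M * t) * b"
      using ip[of "m + r"] q by (simp add: power_int_add M t_def b_def algebra_simps)
    have shift: "m - (r + 1) = m - 1 - r" "m - 1 + (r + 1) = m + r" "q powi (r + 1) = q * t"
      "e (r + 1) = - z * t * e r"
      using q z by (simp_all add: power_int_add t_def e_def theta_term_add_1)
    have G: "G r - G (r + 1) = e r * a * b * ((1 - M * t) + z * t * (1 - M / t))"
      unfolding G_def shift ip1 ip2 a_def[symmetric] b_def[symmetric] by algebra
    have H: "H r - H (r + 1) = e r * a * b * ((1 - M * t) / t + z / q * (1 - M / t))"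
      unfolding H_def shift ip1 ip2 a_def[symmetric] b_def[symmetric] t_def[symmetric]
      using q t by (simp add: field_simps)
    have "(1 - M ^ 2) * (1 - M ^ 2 / q) * (e r * ip (m - r) * ip (m + r))
        - (1 - z * M / q) * (1 - M / z) * (e r * ip (m - 1 - r) * ip (m - 1 + r))
      = e r * a * b * ((1 - M ^ 2) * (1 - M ^ 2 / q) - (1 - z * M / q) * (1 - M / z) * ((1 - M / t) * (1 - M * t)))"
      unfolding ip1 ip2 a_def[symmetric] b_def[symmetric] by algebra
    also have "\<dots> = (1 - z * M / q) * (M / z) * (G r - G (r + 1)) + (1 - M / z) * M * (H r - H (r + 1))"
      unfolding finite_jacobi_identity[OF z q(1) t] G H by (simp only: distrib_left mult_ac)
    finally show ?thesis .
  qed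
  then have "(\<Sum>r = - K..K. (1 - M ^ 2) * (1 - M ^ 2 / q) * (e r * ip (m - r) * ip (m + r))
      - (1 - z * M / q) * (1 - M / z) * (e r * ip (m - 1 - r) * ip (m - 1 + r)))
    = (1 - z * M / q) * (M / z) * ((\<Sum>r = - K..K. G r) - (\<Sum>r = - K..K. G (r + 1)))
    + (1 - M / z) * M * ((\<Sum>r = - K..K. H r) - (\<Sum>r = - K..K. H (r + 1)))"
    by (simp only: sum.distrib sum_subtractf sum_distrib_left[symmetric])
  then have "(1 - M ^ 2) * (1 - M ^ 2 / q) * S = (1 - z * M / q) * (1 - M / z) * S'"
    unfolding G0 H0 S_def S'_def by (simp only: sum_subtractf sum_distrib_left[symmetric]) simp
  moreover have "qpoch q q (2 * Suc n) = (1 - M ^ 2) * (1 - M ^ 2 / q) * P"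
  proof -
    have "q * q ^ (2 * n) = M ^ 2 / q" "q * q ^ (2 * n + 1) = M ^ 2"
      using q by (simp_all add: M_def power_mult_distrib power2_eq_square mult_2 power_add)
    then show ?thesis
      by (simp add: qpoch_Suc P_def)
  qed
  moreover have "qpoch z q (Suc n) * qpoch (q / z) q (Suc n)
     = (1 - z * M / q) * (1 - M / z) * (qpoch z q n * qpoch (q / z) q n)"
    using q by (simp add: qpoch_Suc M_def)
  ultimately have "qpoch q q (2 * Suc n) * S = qpoch z q (Suc n) * qpoch (q / z) q (Suc n)"
    unfolding IH[symmetric] by (simp only: mult_ac)
  then show ?case
    by (simp add: S_def e_def ip_def m_def)
qed

lemma jacobi_triple_product:
  assumes "q \<noteq> 0" "norm q < norm z" "norm z < 1"
  shows "(\<Sum>\<^sub>\<infinity>r. theta_term z q r) = qpoch_inf q q * qpoch_inf z q * qpoch_inf (q / z) q"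
proof -
  have q: "norm q < 1" and z: "z \<noteq> 0"
    using assms by auto
  have "filterlim (\<lambda>n :: nat. 2 * n) at_top at_top"
    by (rule filterlim_at_top_mono[OF filterlim_ident]) auto
  from bilateral_sum_LIMSEQ[OF q theta_term_summable[OF assms] this, of 0 int]
  have "(\<lambda>n. qpoch z q n * qpoch (q / z) q n) \<longlonglongrightarrow> (\<Sum>\<^sub>\<infinity>r. theta_term z q r) / qpoch_inf q q"
    using finite_jacobi_triple_product[OF assms(1) q z] by simp
  moreover have "(\<lambda>n. qpoch z q n * qpoch (q / z) q n) \<longlonglongrightarrow> qpoch_inf z q * qpoch_inf (q / z) q"
    by (intro tendsto_mult qpoch_LIMSEQ q)
  ultimately have "(\<Sum>\<^sub>\<infinity>r. theta_term z q r) / qpoch_inf q q = qpoch_inf z q * qpoch_inf (q / z) q"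
    by (rule LIMSEQ_unique)
  then show ?thesis
    using qpoch_inf_neq_0[OF q] by (simp add: field_simps)
qed

section \<open>The double sums twisted by a cube root of unity\<close>

lemma summable_on_geometric_prod:
  fixes s :: real
  assumes "0 \<le> s" "s < 1"
  shows "(\<lambda>(i, j). s ^ i * s ^ j) summable_on (UNIV :: (nat \<times> nat) set)"
proof -
  have sums: "((\<lambda>n. s ^ n) has_sum (1 / (1 - s))) UNIV"
    using assms geometric_sums[of s] by (intro norm_summable_imp_has_sum) (auto intro: summable_geometric)
  have "(\<lambda>(i, j). s ^ i * s ^ j) summable_on Sigma UNIV (\<lambda>_ :: nat. UNIV :: nat set)"
  proof (rule summable_on_SigmaI)
    show "((\<lambda>j. case (i, j) of (i, j) \<Rightarrow> s ^ i * s ^ j) has_sum (s ^ i * (1 / (1 - s)))) UNIV" for i :: nat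
      using has_sum_cmult_right[OF sums] by simp
    show "(\<lambda>i. s ^ i * (1 / (1 - s))) summable_on UNIV"
      using sums by (intro summable_on_cmult_left) (auto simp: summable_on_def)
  qed (use assms in auto)
  then show ?thesis
    by simp
qed

text \<open>The limit of \<open>qpoch (q ^ 3) (q ^ 3) n * trinomial_term q n x y i j\<close> as
  \<open>n\<close> tends to infinity.\<close>

definition nahm_term :: "complex \<Rightarrow> complex \<Rightarrow> complex \<Rightarrow> nat \<Rightarrow> nat \<Rightarrow> complex" where
  "nahm_term q x y i j = x ^ i * y ^ j * q ^ (2 * i\<^sup>2 + 2 * i * j + 2 * j\<^sup>2)
     / (qpoch (q ^ 3) (q ^ 3) i * qpoch (q ^ 3) (q ^ 3) j)"

text \<open>Isolates the one estimate behind both summability and dominated convergence; the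
  remaining Pochhammer factors are uniformly bounded. The constant \<open>C\<close> leaves room for
  the linear part of the exponent of \<open>S3\<close>.\<close>

locale nahm_bound =
  fixes q x y :: complex and s C :: real
  assumes q: "norm q < 1" and s: "0 \<le> s" "s < 1"
    and bound: "\<And>i j. norm (x ^ i * y ^ j * q ^ (2 * i\<^sup>2 + 2 * i * j + 2 * j\<^sup>2)) \<le> C * (s ^ i * s ^ j)"
begin

lemma norm_cube: "norm (q ^ 3) < 1"
  using q by (simp add: norm_power power_less_one_iff)

lemma C_nonneg: "0 \<le> C"
  using bound[of 0 0] by simp

lemma nahm_summable: "(\<lambda>(i, j). nahm_term q x y i j) summable_on UNIV"
proof -
  obtain B where B: "B > 0" "\<And>k. norm (inv_qpoch (q ^ 3) k) \<le> B"
    using inv_qpoch_bounded[OF norm_cube] by blast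
  have "norm (case p of (i, j) \<Rightarrow> nahm_term q x y i j) \<le> C * (B * B) * (case p of (i, j) \<Rightarrow> s ^ i * s ^ j)" for p
  proof (cases p)
    case (Pair i j)
    have "nahm_term q x y i j = (x ^ i * y ^ j * q ^ (2 * i\<^sup>2 + 2 * i * j + 2 * j\<^sup>2))
       * (inv_qpoch (q ^ 3) (int i) * inv_qpoch (q ^ 3) (int j))"
      by (simp add: nahm_term_def inv_qpoch_of_nat)
    then have "norm (nahm_term q x y i j) \<le> C * (s ^ i * s ^ j) * (B * B)"
      using B bound C_nonneg s by (auto simp only: norm_mult[of "_ * q ^ _"] norm_mult[of "inv_qpoch _ _"]
          intro!: mult_mono mult_nonneg_nonneg zero_le_power norm_ge_zero)
    then show ?thesis
      by (simp add: Pair mult_ac)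
  qed
  from Infinite_Sum.abs_summable_on_comparison_test'[OF summable_on_cmult_right[OF summable_on_geometric_prod[OF s]] this]
  show ?thesis
    by (rule abs_summable_summable)
qed

lemma trinomial_sum_LIMSEQ:
  assumes N: "\<And>n. n \<le> N n"
  shows "(\<lambda>n. trinomial_sum q (N n) n x y) \<longlonglongrightarrow> (\<Sum>\<^sub>\<infinity>(i, j). nahm_term q x y i j)"
proof -
  obtain B where B: "B > 0" "\<And>k. norm (inv_qpoch (q ^ 3) k) \<le> B"
    using inv_qpoch_bounded[OF norm_cube] by blast
  obtain B' where B': "B' > 0" "\<And>k. norm (qpoch (q ^ 3) (q ^ 3) k) \<le> B'"
    using qpoch_bounded[OF norm_cube] by blast
  define f where "f = (\<lambda>n (i, j). qpoch (q ^ 3) (q ^ 3) n * trinomial_term q n x y i j)"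
  have "(\<lambda>n. \<Sum>\<^sub>\<infinity>p. f n p) \<longlonglongrightarrow> (\<Sum>\<^sub>\<infinity>p. case p of (i, j) \<Rightarrow> nahm_term q x y i j)"
  proof (rule tendsto_infsum_dominated)
    show "norm (f n p) \<le> C * (B * B * B * B') * (case p of (i, j) \<Rightarrow> s ^ i * s ^ j)" for n p
    proof (cases p)
      case (Pair i j)
      have "f n p = (x ^ i * y ^ j * q ^ (2 * i\<^sup>2 + 2 * i * j + 2 * j\<^sup>2)) * (inv_qpoch (q ^ 3) (int i)
         * (inv_qpoch (q ^ 3) (int j) * (inv_qpoch (q ^ 3) (int n - int i - int j) * qpoch (q ^ 3) (q ^ 3) n)))"
        by (simp add: Pair f_def trinomial_term_def)
      then have "norm (f n p) \<le> C * (s ^ i * s ^ j) * (B * (B * (B * B')))"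
        using B B' bound C_nonneg s by (auto simp only: norm_mult[of "_ * q ^ _"] norm_mult[of "inv_qpoch _ _"]
            intro!: mult_mono mult_nonneg_nonneg zero_le_power norm_ge_zero)
      then show ?thesis
        by (simp add: Pair mult_ac)
    qed
    show "(\<lambda>p. C * (B * B * B * B') * (case p of (i, j) \<Rightarrow> s ^ i * s ^ j)) summable_on UNIV"
      by (rule summable_on_cmult_right[OF summable_on_geometric_prod[OF s]])
    show "(\<lambda>n. f n p) \<longlonglongrightarrow> (case p of (i, j) \<Rightarrow> nahm_term q x y i j)" for p
    proof (cases p)
      case (Pair i j)
      have "(\<lambda>n. qpoch (q ^ 3) (q ^ 3) n * inv_qpoch (q ^ 3) (int n + (- int i - int j)))
          \<longlonglongrightarrow> qpoch_inf (q ^ 3) (q ^ 3) * (1 / qpoch_inf (q ^ 3) (q ^ 3))"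
        by (intro tendsto_mult qpoch_LIMSEQ inv_qpoch_LIMSEQ norm_cube)
      then have "(\<lambda>n. nahm_term q x y i j * (qpoch (q ^ 3) (q ^ 3) n * inv_qpoch (q ^ 3) (int n + (- int i - int j))))
          \<longlonglongrightarrow> nahm_term q x y i j * 1"
        using qpoch_inf_neq_0[OF norm_cube] by (intro tendsto_mult tendsto_const) simp
      moreover have "f n p = nahm_term q x y i j * (qpoch (q ^ 3) (q ^ 3) n * inv_qpoch (q ^ 3) (int n + (- int i - int j)))" for n
        by (simp add: Pair f_def trinomial_term_def nahm_term_def inv_qpoch_of_nat add_diff_eq)
      ultimately show ?thesis
        by (simp add: Pair)
    qed
  qed
  moreover have "(\<Sum>\<^sub>\<infinity>p. f n p) = trinomial_sum q (N n) n x y" for n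
  proof -
    have "(\<Sum>\<^sub>\<infinity>p. f n p) = (\<Sum>\<^sub>\<infinity>p\<in>{..N n} \<times> {..N n}. f n p)"
    proof (rule infsum_cong_neutral)
      fix p assume "p \<in> UNIV - {..N n} \<times> {..N n}"
      then show "f n p = 0"
        using N[of n] by (cases p) (auto simp: f_def trinomial_term_eq_0)
    qed auto
    also have "\<dots> = trinomial_sum q (N n) n x y"
      by (simp add: f_def trinomial_sum_def sum.cartesian_product sum_distrib_left case_prod_unfold)
    finally show ?thesis .
  qed
  ultimately show ?thesis
    by simp
qed

end

lemma nahm_bound_even:
  assumes "norm q < 1" "norm x = 1" "norm y = 1"
  shows "nahm_bound q x y (norm q) 1"
proof
  fix i j :: nat
  have "i + j \<le> 2 * i\<^sup>2 + 2 * i * j + 2 * j\<^sup>2"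
    using self_le_power[of i 2] self_le_power[of j 2] by (cases "i = 0"; cases "j = 0") auto
  then have "norm q ^ (2 * i\<^sup>2 + 2 * i * j + 2 * j\<^sup>2) \<le> norm q ^ (i + j)"
    using assms by (intro power_decreasing) auto
  then show "norm (x ^ i * y ^ j * q ^ (2 * i\<^sup>2 + 2 * i * j + 2 * j\<^sup>2)) \<le> 1 * (norm q ^ i * norm q ^ j)"
    using assms by (simp add: norm_mult norm_power power_add)
qed (use assms in auto)

text \<open>After subtracting 2i + j the exponent still has to dominate i + j. This fails by one at
  i = 1, j = 0, hence the \<open>Suc\<close> and the constant \<open>1 / norm q\<close> in
  \<open>nahm_bound_odd\<close>.\<close>

lemma odd_exponent_bound: "3 * i + 2 * j \<le> Suc (2 * i\<^sup>2 + 2 * i * j + 2 * j\<^sup>2)" for i j :: nat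
proof -
  have i: "3 * i \<le> Suc (2 * i\<^sup>2)"
  proof (cases "i \<le> 1")
    case False
    then have "2 * i \<le> i\<^sup>2"
      by (simp add: power2_eq_square)
    then show ?thesis
      by simp
  qed (auto simp: le_Suc_eq)
  have "j \<le> j\<^sup>2"
    by (cases "j = 0") (simp_all add: self_le_power)
  with i show ?thesis
    by linarith
qed

lemma nahm_bound_odd:
  assumes "norm q < 1" "q \<noteq> 0" "norm x = 1" "norm y = 1"
  shows "nahm_bound q (x / q ^ 2) (y / q) (norm q) (1 / norm q)"
proof
  fix i j :: nat
  have "norm q ^ Suc (2 * i\<^sup>2 + 2 * i * j + 2 * j\<^sup>2) \<le> norm q ^ (3 * i + 2 * j)"
    using assms odd_exponent_bound by (intro power_decreasing) auto
  also have "\<dots> = norm q ^ i * norm q ^ j * ((norm q ^ 2) ^ i * norm q ^ j)"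
    by (simp add: power_add power_mult power2_eq_square power3_eq_cube power_mult_distrib)
  finally show "norm ((x / q ^ 2) ^ i * (y / q) ^ j * q ^ (2 * i\<^sup>2 + 2 * i * j + 2 * j\<^sup>2))
      \<le> 1 / norm q * (norm q ^ i * norm q ^ j)"
    using assms by (simp add: norm_mult norm_power norm_divide power_divide field_simps)
qed (use assms in auto)

lemma omega_norm:
  fixes w :: complex
  assumes "w ^ 2 + w + 1 = 0"
  shows "norm w = 1"
proof -
  have "w ^ 3 = 1"
    using assms by algebra
  then have "norm w ^ 3 = 1 ^ 3"
    by (simp flip: norm_power)
  then show ?thesis
    by (rule power_eq_imp_eq_base) auto
qed

definition theta_sum :: "complex \<Rightarrow> complex \<Rightarrow> complex" where
  "theta_sum z q = (\<Sum>\<^sub>\<infinity>r. theta_term z q r)"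

lemma norm_power_strict_antimono:
  fixes q :: complex
  assumes "norm q < 1" "q \<noteq> 0" "m < n"
  shows "norm (q ^ n) < norm (q ^ m)"
  using assms unfolding norm_power by (intro power_strict_decreasing) auto

text \<open>By \<open>trinomial_sum_omega_eq_rr\<close> the double sum and the theta quotient are
  limits of one and the same sequence.\<close>

lemma nahm_sum_omega:
  assumes q: "norm q < 1" "q \<noteq> 0" and w: "w ^ 2 + w + 1 = 0"
  shows "(\<Sum>\<^sub>\<infinity>(i, j). nahm_term q w (w ^ 2) i j) = theta_sum (q ^ 2) (q ^ 5) / qpoch_inf (q ^ 3) (q ^ 3)"
    and "(\<Sum>\<^sub>\<infinity>(i, j). nahm_term q (w / q ^ 2) (w ^ 2 / q) i j)
      = - (w ^ 2) * theta_sum (q ^ 4) (q ^ 5) / qpoch_inf (q ^ 3) (q ^ 3)"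
proof -
  have w1: "norm w = 1" "norm (w ^ 2) = 1"
    using omega_norm[OF w] by (simp_all add: norm_power)
  have Q: "norm (q ^ 3) < 1" and q1: "norm (q ^ 2) < 1" "norm (q ^ 4) < 1"
    using q by (simp_all add: norm_power power_less_one_iff)
  have lim: "filterlim (\<lambda>n :: nat. 2 * n) at_top at_top" "filterlim (\<lambda>n :: nat. 2 * n + 1) at_top at_top"
    by (rule filterlim_at_top_mono[OF filterlim_ident], simp)+
  have th: "(\<lambda>r. norm (theta_term (q ^ 2) (q ^ 5) r)) summable_on UNIV"
    "(\<lambda>r. norm (theta_term (q ^ 4) (q ^ 5) r)) summable_on UNIV"
    using q q1 by (auto intro!: theta_term_summable norm_power_strict_antimono)
  have eq: "trinomial_sum q (Suc n) n w (w ^ 2) = rr_even q (int n + 2) n"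
    "trinomial_sum q (Suc n) (Suc n) (w / q ^ 2) (w ^ 2 / q) = - (w ^ 2) * rr_odd q (int n + 2) n" for n
    using trinomial_sum_omega_eq_rr[OF q w, of n "Suc n" "int n + 2"] by auto
  have "(\<lambda>n. rr_even q (int n + 2) n) \<longlonglongrightarrow> theta_sum (q ^ 2) (q ^ 5) / qpoch_inf (q ^ 3) (q ^ 3)"
    unfolding rr_even_def theta_sum_def
    using bilateral_sum_LIMSEQ[OF Q th(1) lim(1), of 0 "\<lambda>n. int n + 2"] by simp
  moreover have "(\<lambda>n. rr_even q (int n + 2) n) \<longlonglongrightarrow> (\<Sum>\<^sub>\<infinity>(i, j). nahm_term q w (w ^ 2) i j)"
    unfolding eq(1)[symmetric] by (rule nahm_bound.trinomial_sum_LIMSEQ[OF nahm_bound_even[OF q(1) w1]]) simp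
  ultimately show "(\<Sum>\<^sub>\<infinity>(i, j). nahm_term q w (w ^ 2) i j) = theta_sum (q ^ 2) (q ^ 5) / qpoch_inf (q ^ 3) (q ^ 3)"
    by (rule LIMSEQ_unique[rotated])
  have "(\<lambda>n. rr_odd q (int n + 2) n) \<longlonglongrightarrow> theta_sum (q ^ 4) (q ^ 5) / qpoch_inf (q ^ 3) (q ^ 3)"
    unfolding rr_odd_def theta_sum_def
    using bilateral_sum_LIMSEQ[OF Q th(2) lim(2), of 1 "\<lambda>n. int n + 2"] by simp
  then have "(\<lambda>n. - (w ^ 2) * rr_odd q (int n + 2) n) \<longlonglongrightarrow> - (w ^ 2) * (theta_sum (q ^ 4) (q ^ 5) / qpoch_inf (q ^ 3) (q ^ 3))"
    by (intro tendsto_mult tendsto_const)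
  moreover have "(\<lambda>n. trinomial_sum q n n (w / q ^ 2) (w ^ 2 / q)) \<longlonglongrightarrow> (\<Sum>\<^sub>\<infinity>(i, j). nahm_term q (w / q ^ 2) (w ^ 2 / q) i j)"
    by (rule nahm_bound.trinomial_sum_LIMSEQ[OF nahm_bound_odd[OF q w1]]) simp
  \<comment> \<open>\<open>LIMSEQ_Suc\<close> absorbs the offset between \<open>rr_odd\<close> at
    \<open>n\<close> and the trinomial sum at \<open>Suc n\<close>.\<close>
  then have "(\<lambda>n. - (w ^ 2) * rr_odd q (int n + 2) n) \<longlonglongrightarrow> (\<Sum>\<^sub>\<infinity>(i, j). nahm_term q (w / q ^ 2) (w ^ 2 / q) i j)"
    unfolding eq(2)[symmetric] by (rule LIMSEQ_Suc)
  ultimately show "(\<Sum>\<^sub>\<infinity>(i, j). nahm_term q (w / q ^ 2) (w ^ 2 / q) i j)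
      = - (w ^ 2) * theta_sum (q ^ 4) (q ^ 5) / qpoch_inf (q ^ 3) (q ^ 3)"
    using LIMSEQ_unique by fastforce
qed

section \<open>Trisection of theta series by residues modulo 3\<close>

lemma theta_term_trisect:
  assumes "z \<noteq> 0" "q \<noteq> 0"
  shows "theta_term z q (3 * n + k) = theta_term z q k * theta_term (z ^ 3 * q powi (3 * k + 3)) (q ^ 9) n"
proof -
  \<comment> \<open>With T(r) = r(r - 1)/2 this says T(3n + k) = 9 T(n) + T(k) + (3k + 3) n.\<close>
  have "(3 * n + k) * (3 * n + k - 1) = 9 * (n * (n - 1)) + k * (k - 1) + (3 * n * (k + 1)) * 2"
    by (simp add: algebra_simps)
  moreover obtain a where a: "n * (n - 1) = 2 * a"
    by (rule evenE[of "n * (n - 1)"]) auto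
  moreover obtain b where b: "k * (k - 1) = 2 * b"
    by (rule evenE[of "k * (k - 1)"]) auto
  ultimately have "(3 * n + k) * (3 * n + k - 1) = 2 * (9 * a + b + (3 * k + 3) * n)"
    by (simp add: algebra_simps)
  then have "(3 * n + k) * (3 * n + k - 1) div 2 = 9 * (n * (n - 1) div 2) + k * (k - 1) div 2 + (3 * k + 3) * n"
    unfolding a b by simp
  then have q: "q powi ((3 * n + k) * (3 * n + k - 1) div 2)
      = (q ^ 9) powi (n * (n - 1) div 2) * q powi (k * (k - 1) div 2) * (q powi (3 * k + 3)) powi n"
    using assms by (simp only:) (simp only: power_int_add power_int_mult power_int_numeral simp_thms)
  have z: "(- z) powi (3 * n + k) = ((- z) ^ 3) powi n * (- z) powi k"
    using assms by (simp only: power_int_add power_int_mult power_int_numeral neg_equal_0_iff_equal simp_thms)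
  have "(- (z ^ 3 * q powi (3 * k + 3))) powi n = ((- z) ^ 3 * q powi (3 * k + 3)) powi n"
    by simp
  also have "\<dots> = ((- z) ^ 3) powi n * (q powi (3 * k + 3)) powi n"
    by (rule power_int_mult_distrib)
  finally show ?thesis
    unfolding theta_term_def q z by (simp only: mult_ac)
qed

text \<open>The residues are represented by 0, 1 and -1 because then all three arguments z^3
  q^(3k+3) lie in the annulus between |q^9| and 1; the representative 2 would leave it.\<close>

lemma theta_sum_trisect:
  assumes "q \<noteq> 0" "norm q < norm z" "norm z < 1"
  shows "theta_sum z q = theta_sum (z ^ 3 * q ^ 3) (q ^ 9) - z * theta_sum (z ^ 3 * q ^ 6) (q ^ 9)
    - q / z * theta_sum (z ^ 3) (q ^ 9)"
proof -
  have z: "z \<noteq> 0"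
    using assms by auto
  define f where "f = theta_term z q"
  have "f summable_on UNIV"
    using theta_term_summable[OF assms] unfolding f_def by (rule abs_summable_summable)
  then have sum: "f summable_on A" for A
    by (rule summable_on_subset_banach) simp
  define A where "A = (\<lambda>k. range (\<lambda>n :: int. 3 * n + k))"
  have inj: "inj (\<lambda>n :: int. 3 * n + k)" for k
    by (auto simp: inj_on_def)
  have A: "infsum f (A k) = f k * theta_sum (z ^ 3 * q powi (3 * k + 3)) (q ^ 9)" for k
    unfolding A_def theta_sum_def infsum_reindex[OF inj] o_def f_def theta_term_trisect[OF z assms(1)]
    by (rule infsum_cmult_right')
  have mod: "r \<in> A k \<longleftrightarrow> (r - k) mod 3 = 0" for r k
  proof
    assume "(r - k) mod 3 = 0"
    then have "r = 3 * ((r - k) div 3) + k"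
      by presburger
    then show "r \<in> A k"
      unfolding A_def by (rule range_eqI)
  qed (auto simp: A_def)
  have UNIV: "UNIV = A 0 \<union> A 1 \<union> A (- 1)"
  proof -
    have "r \<in> A 0 \<union> A 1 \<union> A (- 1)" for r
      unfolding Un_iff mod by presburger
    then show ?thesis
      by blast
  qed
  have "A 0 \<inter> A 1 = {}" "(A 0 \<union> A 1) \<inter> A (- 1) = {}"
    unfolding disjoint_iff Un_iff mod by presburger+
  then have "infsum f (A 0 \<union> A 1 \<union> A (- 1)) = infsum f (A 0) + infsum f (A 1) + infsum f (A (- 1))"
    by (simp add: infsum_Un_disjoint sum)
  then have "theta_sum z q = infsum f (A 0) + infsum f (A 1) + infsum f (A (- 1))"
    unfolding UNIV[symmetric] by (simp add: theta_sum_def f_def)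
  moreover have "f 0 = 1" "f 1 = - z" "f (- 1) = - (q / z)"
    using z by (simp_all add: f_def theta_term_def power_int_minus divide_inverse)
  ultimately show ?thesis
    unfolding A by simp
qed

section \<open>Removing the twist\<close>

lemma theta_sum_product:
  fixes q :: complex
  assumes "norm q < 1" "q \<noteq> 0" "0 < a" "a < m"
  shows "theta_sum (q ^ a) (q ^ m) = qpoch_inf (q ^ m) (q ^ m) * (qpoch_inf (q ^ a) (q ^ m) * qpoch_inf (q ^ (m - a)) (q ^ m))"
proof -
  have "norm (q ^ a) < 1"
    using assms by (simp add: norm_power power_less_one_iff)
  moreover have "q ^ m / q ^ a = q ^ (m - a)"
    using assms by (simp add: power_diff)
  ultimately show ?thesis
    unfolding theta_sum_def
    using assms by (subst jacobi_triple_product) (auto simp: norm_power_strict_antimono mult.assoc)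
qed

text \<open>All theta arguments on the right are powers of \<open>q ^ 3\<close>, so replacing
  \<open>q\<close> by \<open>w * q\<close> affects only the coefficients in front.\<close>

lemma theta_sum_trisect_power:
  fixes q :: complex
  assumes "norm q < 1" "q \<noteq> 0"
  shows "theta_sum (q ^ 2) (q ^ 5) = theta_sum (q ^ 21) (q ^ 45) - q ^ 2 * theta_sum (q ^ 36) (q ^ 45)
      - q ^ 3 * theta_sum (q ^ 6) (q ^ 45)"
    and "theta_sum (q ^ 4) (q ^ 5) = theta_sum (q ^ 27) (q ^ 45) - q ^ 4 * theta_sum (q ^ 42) (q ^ 45)
      - q * theta_sum (q ^ 12) (q ^ 45)"
proof -
  have "norm (q ^ 2) < 1" "norm (q ^ 4) < 1"
    using assms by (simp_all add: norm_power power_less_one_iff)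
  moreover have "q ^ 5 / q ^ 2 = q ^ 3" "q ^ 5 / q ^ 4 = q"
    using assms power_diff[of q 2 5] power_diff[of q 4 5] by simp_all
  ultimately show "theta_sum (q ^ 2) (q ^ 5) = theta_sum (q ^ 21) (q ^ 45) - q ^ 2 * theta_sum (q ^ 36) (q ^ 45)
      - q ^ 3 * theta_sum (q ^ 6) (q ^ 45)"
    and "theta_sum (q ^ 4) (q ^ 5) = theta_sum (q ^ 27) (q ^ 45) - q ^ 4 * theta_sum (q ^ 42) (q ^ 45)
      - q * theta_sum (q ^ 12) (q ^ 45)"
    using theta_sum_trisect[of "q ^ 5" "q ^ 2"] theta_sum_trisect[of "q ^ 5" "q ^ 4"] assms
    by (simp_all add: norm_power_strict_antimono flip: power_mult power_add)
qed

lemma omega_power_mod: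
  fixes w :: complex
  assumes "w ^ 3 = 1"
  shows "w ^ k = w ^ (k mod 3)"
proof -
  have "w ^ k = w ^ (3 * (k div 3) + k mod 3)"
    by simp
  also have "\<dots> = w ^ (k mod 3)"
    unfolding power_add power_mult assms by simp
  finally show ?thesis .
qed

lemma quadratic_exponent_mod_3:
  "(2 * i\<^sup>2 + 2 * i * j + 2 * j\<^sup>2) mod 3 =
   (2 * (i mod 3)\<^sup>2 + 2 * (i mod 3) * (j mod 3) + 2 * (j mod 3)\<^sup>2) mod (3 :: nat)"
  unfolding power2_eq_square by (intro mod_add_cong mod_mult_cong) simp_all

lemma mod_3_cases:
  fixes i :: nat
  obtains "i mod 3 = 0" | "i mod 3 = 1" | "i mod 3 = 2"
  by linarith

text \<open>The constant function as a combination of the three functions of \<open>i - j\<close> modulo 3 for which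
  the sum is known: the characters \<open>w\<close> and \<open>w\<^sup>2\<close> at \<open>q\<close>, and the character \<open>w\<close> at \<open>w q\<close>.\<close>
lemma omega_character_even:
  fixes w :: complex
  assumes w: "w ^ 2 + w + 1 = 0"
  shows "- (w ^ 2) * (w ^ i * (w ^ 2) ^ j) - (w ^ 2) ^ i * ((w ^ 2) ^ 2) ^ j
    + (1 - w) * (w ^ i * (w ^ 2) ^ j * w ^ (2 * i\<^sup>2 + 2 * i * j + 2 * j\<^sup>2)) = 1"
proof -
  have w3: "w ^ 3 = 1"
    using w by algebra
  have 1: "(w ^ 2) ^ k = (w ^ k) ^ 2" "((w ^ 2) ^ 2) ^ k = (w ^ k) ^ 4" for k
    by (simp_all add: mult.commute flip: power_mult)
  have 2: "w ^ (2 * i\<^sup>2 + 2 * i * j + 2 * j\<^sup>2) =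
      w ^ ((2 * (i mod 3)\<^sup>2 + 2 * (i mod 3) * (j mod 3) + 2 * (j mod 3)\<^sup>2) mod 3)"
    unfolding quadratic_exponent_mod_3[symmetric] by (rule omega_power_mod[OF w3])
  \<comment> \<open>Reduction table for the powers that arise once the residues of \<open>i\<close>
    and \<open>j\<close> are inserted.\<close>
  have 3: "w ^ 4 = w" "w ^ 6 = 1" "w ^ 8 = w ^ 2" "w ^ 10 = w" "w ^ 12 = 1" "w ^ 14 = w ^ 2" "w ^ 2 = - 1 - w" "w * w = - 1 - w"
    "(- 1 - w) ^ 2 = w" "(- 1 - w) ^ 4 = - 1 - w" "(- 1 - w) ^ 6 = 1"
    using w by algebra+
  show ?thesis
    unfolding 1[of i] 1[of j] 2 omega_power_mod[OF w3, of i] omega_power_mod[OF w3, of j]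
    by (cases i rule: mod_3_cases; cases j rule: mod_3_cases) (simp_all add: 3 algebra_simps)
qed

text \<open>Counterpart for \<open>S3\<close>. Passing to \<open>w * q\<close> also changes the
  linear part of the exponent, so the third function starts from (w^2)^i w^j. Modulo 3 the quadratic
  exponent is 2(i - j)^2, so only i - j matters.\<close>

lemma omega_character_odd:
  fixes w :: complex
  assumes w: "w ^ 2 + w + 1 = 0"
  shows "- (w ^ i * (w ^ 2) ^ j) - w ^ 2 * ((w ^ 2) ^ i * ((w ^ 2) ^ 2) ^ j)
    + (1 - w) * ((w ^ 2) ^ i * w ^ j * w ^ (2 * i\<^sup>2 + 2 * i * j + 2 * j\<^sup>2)) = 1"
proof -
  have w3: "w ^ 3 = 1"
    using w by algebra
  have 1: "(w ^ 2) ^ k = (w ^ k) ^ 2" "((w ^ 2) ^ 2) ^ k = (w ^ k) ^ 4" for k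
    by (simp_all add: mult.commute flip: power_mult)
  have 2: "w ^ (2 * i\<^sup>2 + 2 * i * j + 2 * j\<^sup>2) =
      w ^ ((2 * (i mod 3)\<^sup>2 + 2 * (i mod 3) * (j mod 3) + 2 * (j mod 3)\<^sup>2) mod 3)"
    unfolding quadratic_exponent_mod_3[symmetric] by (rule omega_power_mod[OF w3])
  have 3: "w ^ 4 = w" "w ^ 6 = 1" "w ^ 8 = w ^ 2" "w ^ 10 = w" "w ^ 12 = 1" "w ^ 14 = w ^ 2" "w ^ 2 = - 1 - w" "w * w = - 1 - w"
    "(- 1 - w) ^ 2 = w" "(- 1 - w) ^ 4 = - 1 - w" "(- 1 - w) ^ 6 = 1"
    using w by algebra+
  show ?thesis
    unfolding 1[of i] 1[of j] 2 omega_power_mod[OF w3, of i] omega_power_mod[OF w3, of j]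
    by (cases i rule: mod_3_cases; cases j rule: mod_3_cases) (simp_all add: 3 algebra_simps)
qed

lemma S4_eq_nahm: "S4 q = (\<Sum>\<^sub>\<infinity>(i, j). nahm_term q 1 1 i j)"
  by (simp add: S4_def nahm_term_def)

lemma S3_eq_nahm:
  assumes "q \<noteq> 0"
  shows "S3 q = (\<Sum>\<^sub>\<infinity>(i, j). nahm_term q (1 / q ^ 2) (1 / q) i j)"
proof -
  have "q ^ (2 * i\<^sup>2 + 2 * i * j + 2 * j\<^sup>2 - 2 * i - j) =
      (1 / q ^ 2) ^ i * (1 / q) ^ j * q ^ (2 * i\<^sup>2 + 2 * i * j + 2 * j\<^sup>2)" for i j
  proof -
    \<comment> \<open>The subtraction of natural numbers in \<open>S3\<close> is never
      truncated.\<close>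
    have "2 * i + j \<le> 2 * i\<^sup>2 + 2 * i * j + 2 * j\<^sup>2"
      using self_le_power[of i 2] self_le_power[of j 2] by (cases "i = 0"; cases "j = 0") auto
    then have "q ^ (2 * i\<^sup>2 + 2 * i * j + 2 * j\<^sup>2) = q ^ (2 * i\<^sup>2 + 2 * i * j + 2 * j\<^sup>2 - 2 * i - j) * q ^ (2 * i + j)"
      by (subst power_add[symmetric]) simp
    then show ?thesis
      using assms by (simp add: power_divide power_add flip: power_mult)
  qed
  then show ?thesis
    by (simp add: S3_def nahm_term_def)
qed

text \<open>The denominators see \<open>q\<close> only through \<open>q ^ 3\<close>, which is
  unchanged under multiplication of \<open>q\<close> by a cube root of unity.\<close>

lemma nahm_term_scale:
  assumes "w ^ 3 = 1"
  shows "nahm_term (w * q) (u * x) (v * y) i j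
    = u ^ i * v ^ j * w ^ (2 * i\<^sup>2 + 2 * i * j + 2 * j\<^sup>2) * nahm_term q x y i j"
proof -
  have "(w * q) ^ 3 = q ^ 3"
    by (simp add: power_mult_distrib assms)
  then show ?thesis
    unfolding nahm_term_def by (simp only:) (simp add: power_mult_distrib mult_ac)
qed

lemma infsum_linear_comb_3:
  fixes f g h :: "'a \<Rightarrow> complex"
  assumes "f summable_on UNIV" "g summable_on UNIV" "h summable_on UNIV"
  shows "(\<Sum>\<^sub>\<infinity>p. a * f p + b * g p + c * h p) = a * infsum f UNIV + b * infsum g UNIV + c * infsum h UNIV"
  using assms by (simp add: infsum_add summable_on_add summable_on_cmult_right infsum_cmult_right)

text \<open>Since \<open>w ^ 2\<close> is again a primitive cube root of unity, \<open>f\<close> and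
  \<open>g\<close> have the same theta quotient as sum; their coefficients add up to - w^2 - 1 =
  w.\<close>

lemma S4_theta:
  assumes q: "norm q < 1" "q \<noteq> 0" and w: "w ^ 2 + w + 1 = 0"
  shows "S4 q = (w * theta_sum (q ^ 2) (q ^ 5) + (1 - w) * theta_sum ((w * q) ^ 2) ((w * q) ^ 5))
    / qpoch_inf (q ^ 3) (q ^ 3)"
proof -
  have w': "(w ^ 2) ^ 2 + w ^ 2 + 1 = 0" and w3: "w ^ 3 = 1"
    using w by algebra+
  have n: "norm w = 1" "norm (w ^ 2) = 1" "norm ((w ^ 2) ^ 2) = 1"
    using omega_norm[OF w] by (simp_all add: norm_power)
  have wq: "norm (w * q) < 1" "w * q \<noteq> 0"
    using q n by (auto simp: norm_mult)
  have wq3: "(w * q) ^ 3 = q ^ 3"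
    by (simp add: power_mult_distrib w3)
  define f where "f = (\<lambda>(i, j). nahm_term q w (w ^ 2) i j)"
  define g where "g = (\<lambda>(i, j). nahm_term q (w ^ 2) ((w ^ 2) ^ 2) i j)"
  define h where "h = (\<lambda>(i, j). nahm_term (w * q) w (w ^ 2) i j)"
  have sum: "f summable_on UNIV" "g summable_on UNIV" "h summable_on UNIV"
    unfolding f_def g_def h_def
    by (rule nahm_bound.nahm_summable[OF nahm_bound_even]; fact)+
  have "(case p of (i, j) \<Rightarrow> nahm_term q 1 1 i j) = - (w ^ 2) * f p + - 1 * g p + (1 - w) * h p" for p
  proof (cases p)
    case (Pair i j)
    define t where "t = nahm_term q 1 1 i j"
    have split: "nahm_term q u v i j = u ^ i * v ^ j * t" for u v
      by (simp add: t_def nahm_term_def)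
    have "h p = w ^ i * (w ^ 2) ^ j * w ^ (2 * i\<^sup>2 + 2 * i * j + 2 * j\<^sup>2) * t"
      using nahm_term_scale[OF w3, of q w 1 "w ^ 2" 1 i j] by (simp only: Pair h_def prod.case mult_1_right t_def)
    then have "- (w ^ 2) * f p + - 1 * g p + (1 - w) * h p =
       (- (w ^ 2) * (w ^ i * (w ^ 2) ^ j) - (w ^ 2) ^ i * ((w ^ 2) ^ 2) ^ j
        + (1 - w) * (w ^ i * (w ^ 2) ^ j * w ^ (2 * i\<^sup>2 + 2 * i * j + 2 * j\<^sup>2))) * t"
      unfolding Pair f_def g_def prod.case split by (simp add: algebra_simps)
    then show ?thesis
      unfolding omega_character_even[OF w] by (simp add: Pair t_def)
  qed
  then have "S4 q = - (w ^ 2) * infsum f UNIV + - 1 * infsum g UNIV + (1 - w) * infsum h UNIV"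
    unfolding S4_eq_nahm infsum_linear_comb_3[OF sum, symmetric] by (rule infsum_cong)
  also have "\<dots> = - (w ^ 2) * (theta_sum (q ^ 2) (q ^ 5) / qpoch_inf (q ^ 3) (q ^ 3))
      + - 1 * (theta_sum (q ^ 2) (q ^ 5) / qpoch_inf (q ^ 3) (q ^ 3))
      + (1 - w) * (theta_sum ((w * q) ^ 2) ((w * q) ^ 5) / qpoch_inf (q ^ 3) (q ^ 3))"
    using nahm_sum_omega(1)[OF q w] nahm_sum_omega(1)[OF q w'] nahm_sum_omega(1)[OF wq w]
    by (simp add: f_def g_def h_def wq3)
  also have "\<dots> = ((- (w ^ 2) - 1) * theta_sum (q ^ 2) (q ^ 5) + (1 - w) * theta_sum ((w * q) ^ 2) ((w * q) ^ 5))
    / qpoch_inf (q ^ 3) (q ^ 3)"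
    by (simp add: diff_divide_distrib add_divide_distrib algebra_simps)
  also have "- (w ^ 2) - 1 = w"
    using w by algebra
  finally show ?thesis .
qed

lemma S3_theta:
  assumes q: "norm q < 1" "q \<noteq> 0" and w: "w ^ 2 + w + 1 = 0"
  shows "S3 q = (- w * theta_sum (q ^ 4) (q ^ 5) + (1 - w ^ 2) * theta_sum ((w * q) ^ 4) ((w * q) ^ 5))
    / qpoch_inf (q ^ 3) (q ^ 3)"
proof -
  have w': "(w ^ 2) ^ 2 + w ^ 2 + 1 = 0" and w3: "w ^ 3 = 1"
    using w by algebra+
  have n: "norm w = 1" "norm (w ^ 2) = 1" "norm ((w ^ 2) ^ 2) = 1"
    using omega_norm[OF w] by (simp_all add: norm_power)
  have wq: "norm (w * q) < 1" "w * q \<noteq> 0"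
    using q n by (auto simp: norm_mult)
  have wq3: "(w * q) ^ 3 = q ^ 3"
    by (simp add: power_mult_distrib w3)
  define f where "f = (\<lambda>(i, j). nahm_term q (w / q ^ 2) (w ^ 2 / q) i j)"
  define g where "g = (\<lambda>(i, j). nahm_term q (w ^ 2 / q ^ 2) ((w ^ 2) ^ 2 / q) i j)"
  define h where "h = (\<lambda>(i, j). nahm_term (w * q) (w / (w * q) ^ 2) (w ^ 2 / (w * q)) i j)"
  have sum: "f summable_on UNIV" "g summable_on UNIV" "h summable_on UNIV"
    unfolding f_def g_def h_def
    by (rule nahm_bound.nahm_summable[OF nahm_bound_odd]; fact)+
  have "w \<noteq> 0"
    using n by auto
  \<comment> \<open>Division by \<open>w * q\<close> instead of \<open>q\<close> turns the twist (w,
    w^2) into (w^2, w).\<close>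
  then have h_args: "w / (w * q) ^ 2 = w ^ 2 * (1 / q ^ 2)" "w ^ 2 / (w * q) = w * (1 / q)"
    using q w3 by (simp_all add: divide_simps power_mult_distrib power2_eq_square power3_eq_cube)
  have "(case p of (i, j) \<Rightarrow> nahm_term q (1 / q ^ 2) (1 / q) i j) = - 1 * f p + - (w ^ 2) * g p + (1 - w) * h p" for p
  proof (cases p)
    case (Pair i j)
    define t where "t = nahm_term q (1 / q ^ 2) (1 / q) i j"
    have split: "nahm_term q (u / q ^ 2) (v / q) i j = u ^ i * v ^ j * t" for u v
      by (simp add: t_def nahm_term_def power_divide)
    have "h p = (w ^ 2) ^ i * w ^ j * w ^ (2 * i\<^sup>2 + 2 * i * j + 2 * j\<^sup>2) * t"
      unfolding Pair h_def t_def h_args prod.case by (rule nahm_term_scale[OF w3])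
    then have "- 1 * f p + - (w ^ 2) * g p + (1 - w) * h p =
       (- (w ^ i * (w ^ 2) ^ j) - w ^ 2 * ((w ^ 2) ^ i * ((w ^ 2) ^ 2) ^ j)
        + (1 - w) * ((w ^ 2) ^ i * w ^ j * w ^ (2 * i\<^sup>2 + 2 * i * j + 2 * j\<^sup>2))) * t"
      unfolding Pair f_def g_def prod.case split by (simp add: algebra_simps)
    then show ?thesis
      unfolding omega_character_odd[OF w] by (simp add: Pair t_def)
  qed
  then have "S3 q = - 1 * infsum f UNIV + - (w ^ 2) * infsum g UNIV + (1 - w) * infsum h UNIV"
    unfolding S3_eq_nahm[OF q(2)] infsum_linear_comb_3[OF sum, symmetric] by (rule infsum_cong)
  also have "\<dots> = - 1 * (- (w ^ 2) * theta_sum (q ^ 4) (q ^ 5) / qpoch_inf (q ^ 3) (q ^ 3))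
      + - (w ^ 2) * (- ((w ^ 2) ^ 2) * theta_sum (q ^ 4) (q ^ 5) / qpoch_inf (q ^ 3) (q ^ 3))
      + (1 - w) * (- (w ^ 2) * theta_sum ((w * q) ^ 4) ((w * q) ^ 5) / qpoch_inf (q ^ 3) (q ^ 3))"
    using nahm_sum_omega(2)[OF q w] nahm_sum_omega(2)[OF q w'] nahm_sum_omega(2)[OF wq w]
    by (simp add: f_def g_def h_def wq3)
  also have "\<dots> = ((w ^ 2 + (w ^ 3) ^ 2) * theta_sum (q ^ 4) (q ^ 5) + (w ^ 3 - w ^ 2) * theta_sum ((w * q) ^ 4) ((w * q) ^ 5))
    / qpoch_inf (q ^ 3) (q ^ 3)"
    by (simp add: diff_divide_distrib add_divide_distrib algebra_simps power2_eq_square power3_eq_cube)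
  also have "w ^ 2 + (w ^ 3) ^ 2 = - w"
    using w by algebra
  finally show ?thesis
    unfolding w3 .
qed

section \<open>The case q = 0, and the conclusion\<close>

lemma qpoch_inf_0 [simp]: "qpoch_inf 0 q = 1"
  by (simp add: qpoch_inf_def)

lemma qpoch_0_0 [simp]: "qpoch 0 q n = 1"
  by (simp add: qpoch_def)

lemma S4_at_0: "S4 0 = 1"
proof -
  have *: "(0 :: complex) ^ (2 * i\<^sup>2 + 2 * i * j + 2 * j\<^sup>2) = (if (i, j) = (0, 0) then 1 else 0)" for i j :: nat
    by (auto simp: power_0_left split: if_splits)
  have "S4 0 = (\<Sum>\<^sub>\<infinity>p. if p = (0 :: nat, 0 :: nat) then 1 else 0 :: complex)"
    unfolding S4_def * by (intro infsum_cong) (auto split: if_splits)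
  also have "\<dots> = (\<Sum>\<^sub>\<infinity>p\<in>{(0 :: nat, 0 :: nat)}. 1 :: complex)"
    by (intro infsum_cong_neutral) auto
  finally show ?thesis
    by simp
qed

text \<open>By \<open>0 ^ 0 = 1\<close> every pair with vanishing exponent contributes 1, and there
  are two: (0, 0) and (1, 0).\<close>

lemma S3_at_0: "S3 0 = 2"
proof -
  have exp: "2 * i\<^sup>2 + 2 * i * j + 2 * j\<^sup>2 - 2 * i - j = 0 \<longleftrightarrow> j = 0 \<and> (i = 0 \<or> i = 1)" for i j :: nat
  proof -
    have i: "2 * i \<le> 2 * i\<^sup>2" and j: "2 * j \<le> 2 * j\<^sup>2"
      using self_le_power[of i 2] self_le_power[of j 2] by (cases "i = 0"; cases "j = 0"; simp)+
    show ?thesis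
    proof
      assume *: "2 * i\<^sup>2 + 2 * i * j + 2 * j\<^sup>2 - 2 * i - j = 0"
      then have "2 * i\<^sup>2 + 2 * j\<^sup>2 \<le> 2 * i + j"
        by simp
      with i j have "j = 0" "i\<^sup>2 = i"
        by linarith+
      then show "j = 0 \<and> (i = 0 \<or> i = 1)"
        by (simp add: power2_eq_square)
    qed auto
  qed
  have *: "(0 :: complex) ^ (2 * i\<^sup>2 + 2 * i * j + 2 * j\<^sup>2 - 2 * i - j)
      = (if (i, j) = (0, 0) \<or> (i, j) = (1, 0) then 1 else 0)" for i j :: nat
    unfolding power_0_left exp by auto
  have "S3 0 = (\<Sum>\<^sub>\<infinity>p. if p = (0 :: nat, 0 :: nat) \<or> p = (1, 0) then 1 else 0 :: complex)"
    unfolding S3_def * by (intro infsum_cong) (auto split: if_splits)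
  also have "\<dots> = (\<Sum>\<^sub>\<infinity>p\<in>{(0 :: nat, 0 :: nat), (1, 0)}. 1 :: complex)"
    by (intro infsum_cong_neutral) auto
  finally show ?thesis
    by simp
qed

lemma exists_omega: "\<exists>w :: complex. w ^ 2 + w + 1 = 0"
proof
  show "(cis (2 * pi / 3)) ^ 2 + cis (2 * pi / 3) + 1 = 0"
    by (simp add: complex_eq_iff power2_eq_square cos_120 sin_120 DeMoivre)
qed

theorem theorem1p4:
  fixes q :: complex
  assumes "norm q < 1"
  shows "(S3 q = qpoch_inf (q^45) (q^45) / qpoch_inf (q^3) (q^3) *
           (2 * qpoch_inf (q^18) (q^45) * qpoch_inf (q^27) (q^45)
            + q * qpoch_inf (q^12) (q^45) * qpoch_inf (q^33) (q^45)
            + q^4 * qpoch_inf (q^3) (q^45) * qpoch_inf (q^42) (q^45))) \<and>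
         (S4 q = qpoch_inf (q^45) (q^45) / qpoch_inf (q^3) (q^3) *
           (qpoch_inf (q^21) (q^45) * qpoch_inf (q^24) (q^45)
            - q^3 * qpoch_inf (q^6) (q^45) * qpoch_inf (q^39) (q^45)
            + 2 * q^2 * qpoch_inf (q^9) (q^45) * qpoch_inf (q^36) (q^45)))"
proof (cases "q = 0")
  case True
  then show ?thesis
    by (simp add: S3_at_0 S4_at_0)
next
  case False
  obtain w :: complex where w: "w ^ 2 + w + 1 = 0"
    using exists_omega by blast
  have w3: "w ^ 3 = 1"
    using w by algebra
  have wq: "norm (w * q) < 1" "w * q \<noteq> 0"
    using assms False omega_norm[OF w] by (auto simp: norm_mult)
  have wq_power: "(w * q) ^ (3 * k) = q ^ (3 * k)" for k
    by (simp add: power_mult power_mult_distrib w3)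
  note wq_powers = wq_power[of 7] wq_power[of 15] wq_power[of 12] wq_power[of 2] wq_power[of 9] wq_power[of 14]
    wq_power[of 4] wq_power[of 1]
  have J: "theta_sum (q ^ a) (q ^ 45) = qpoch_inf (q ^ 45) (q ^ 45) * (qpoch_inf (q ^ a) (q ^ 45) * qpoch_inf (q ^ (45 - a)) (q ^ 45))"
    if "0 < a" "a < 45" for a
    using theta_sum_product[OF assms False that] .
  define T where "T = (\<lambda>a. theta_sum (q ^ a) (q ^ 45))"
  have V: "theta_sum (q ^ 2) (q ^ 5) = T 21 - q ^ 2 * T 36 - q ^ 3 * T 6"
    "theta_sum ((w * q) ^ 2) ((w * q) ^ 5) = T 21 - (w * q) ^ 2 * T 36 - q ^ 3 * T 6"
    and W: "theta_sum (q ^ 4) (q ^ 5) = T 27 - q ^ 4 * T 42 - q * T 12"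
    "theta_sum ((w * q) ^ 4) ((w * q) ^ 5) = T 27 - (w * q) ^ 4 * T 42 - w * q * T 12"
    using theta_sum_trisect_power[OF assms False] theta_sum_trisect_power[OF wq] wq_powers by (simp_all add: T_def)
  \<comment> \<open>The coefficient w + (1 - w) of \<open>T 21\<close> and
    \<open>- q ^ 3 * T 6\<close> is 1; that of \<open>q ^ 2 * T 36\<close> is - w - (1 - w) w^2 =
    2.\<close>
  have "w * theta_sum (q ^ 2) (q ^ 5) + (1 - w) * theta_sum ((w * q) ^ 2) ((w * q) ^ 5)
      = T 21 - q ^ 3 * T 6 + 2 * q ^ 2 * T 36"
    unfolding V using w by algebra
  then have S4: "S4 q = (T 21 - q ^ 3 * T 6 + 2 * q ^ 2 * T 36) / qpoch_inf (q ^ 3) (q ^ 3)"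
    using S4_theta[OF assms False w] by simp
  \<comment> \<open>Here \<open>T 27\<close> gets 1 - w - w^2 = 2, while \<open>q * T 12\<close>
    gets w - (1 - w^2) w = 1 and \<open>q ^ 4 * T 42\<close> the same, as w^4 = w.\<close>
  have "- w * theta_sum (q ^ 4) (q ^ 5) + (1 - w ^ 2) * theta_sum ((w * q) ^ 4) ((w * q) ^ 5)
      = 2 * T 27 + q * T 12 + q ^ 4 * T 42"
    unfolding W using w by algebra
  then have S3: "S3 q = (2 * T 27 + q * T 12 + q ^ 4 * T 42) / qpoch_inf (q ^ 3) (q ^ 3)"
    using S3_theta[OF assms False w] by simp
  show ?thesis
    unfolding S3 S4 T_def by (simp add: J algebra_simps add_divide_distrib diff_divide_distrib)
qed

end
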